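(* Let $n\in\mathbb{N}$, let $a<b$, and let $p,q\in[1,\infty]$ be conjugate exponents. Let $f\colon[a,b]\to\mathbb{R}$ be such that $f^{(n-1)}$ is absolutely continuous on $[a,b]$ and $f^{(n)}\in L^p([a,b])$. Let $\phi_n$ be a monic polynomial of degree $n$. Then $$\int_a^b f(x)\,dx = \frac{(-1)^n}{n!}\sum_{k=0}^{n-1}(-1)^{n-k-1}\left[\phi_n^{(n-k-1)}(a)f^{(k)}(a)- \phi_n^{(n-k-1)}(b)f^{(k)}(b)\right]+E_n(f),$$ where $E_n(f)=\frac{(-1)^n}{n!}\int_a^b f^{(n)}(x)\phi_n(x)\,dx$. Write $\phi_n(x)=\left(\frac{b-a}{2}\right)^n\tilde\phi_n\!\left(\frac{2x-a-b}{b-a}\right)$, so that $\tilde\phi_n$ is a monic polynomial of degree $n$, and set $K_{n,p}=2^{-n-1/q}\|\tilde\phi_n\|_{q}/n!$, where $\|\tilde\phi_n\|_q$ denotes the $L^q$ norm over $[-1,1]$ (the maximum of $|\tilde\phi_n|$ on $[-1,1]$ if $q=\infty$). Then $$|E_n(f)|\leq \frac{\|f^{(n)}\|_p\|\phi_n\|_q}{n!}\leq K_{n,p}\|f^{(n)}\|_p(b-a)^{n+1/q},$$ where the norms $\|f^{(n)}\|_p$, $\|\phi_n\|_q$ are over $[a,b]$; the constant $K_{n,p}$ depends on $n$, $p$ and $\tilde\phi_n$ but not on $f$ or $b-a$. There is a unique monic polynomial $\tilde\phi_n$ of degree $n$ that minimizes $K_{n,p}$, and the minimum value is $\tilde K_{n,p}=2^{-n-1/q}\|\tilde\phi_n\|_q/n!$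 for this polynomial. With this choice of $\tilde\phi_n$ the estimate on $|E_n(f)|$ is sharp, in the sense that the coefficient of $\|f^{(n)}\|_p$ cannot be reduced (i.e. no smaller constant makes the inequality hold for all such $f$).
   Context: $L^p([a,b])$ is the Lebesgue space with norm $\|g\|_p=(\int_a^b|g|^p)^{1/p}$ for $1\le p<\infty$ and $\|g\|_\infty=\operatorname{ess\,sup}|g|$. Conjugate exponents satisfy $1/p+1/q=1$ with the convention $1/\infty=0$. A monic polynomial is one with leading coefficient $1$. *)

theory Defs
  imports "HOL-Analysis.Analysis" "HOL-Computational_Algebra.Polynomial"
begin

definition abs_cont_on :: "real \<Rightarrow> real \<Rightarrow> (real \<Rightarrow> real) \<Rightarrow> bool" where
  "abs_cont_on a b g \<longleftrightarrow>
     (\<forall>\<epsilon>>0. \<exists>\<delta>>0. \<forall>(m::nat) (u::nat \<Rightarrow> real) v.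
        (\<forall>i<m. a \<le> u i \<and> u i \<le> v i \<and> v i \<le> b) \<and>
        (\<forall>i<m. \<forall>j<m. i \<noteq> j \<longrightarrow> v i \<le> u j \<or> v j \<le> u i) \<and>
        (\<Sum>i<m. v i - u i) < \<delta>
        \<longrightarrow> (\<Sum>i<m. \<bar>g (v i) - g (u i)\<bar>) < \<epsilon>)"

definition conjugate_exps :: "ereal \<Rightarrow> ereal \<Rightarrow> bool" where
  "conjugate_exps p q \<longleftrightarrow>
     (p = \<infinity> \<and> q = 1) \<or> (p = 1 \<and> q = \<infinity>) \<or>
     (\<exists>r s. p = ereal r \<and> q = ereal s \<and> r > 1 \<and> s > 1 \<and> 1 / r + 1 / s = 1)"

definition inv_exp :: "ereal \<Rightarrow> real" where
  "inv_exp q = (if q = \<infinity> then 0 else 1 / real_of_ereal q)"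

definition in_Lp :: "ereal \<Rightarrow> real \<Rightarrow> real \<Rightarrow> (real \<Rightarrow> real) \<Rightarrow> bool" where
  "in_Lp p a b g \<longleftrightarrow> g \<in> borel_measurable (lebesgue_on {a..b}) \<and>
     (if p = \<infinity> then (\<exists>C. AE x in lebesgue_on {a..b}. \<bar>g x\<bar> \<le> C)
      else integrable (lebesgue_on {a..b}) (\<lambda>x. \<bar>g x\<bar> powr real_of_ereal p))"

definition Lp_norm :: "ereal \<Rightarrow> real \<Rightarrow> real \<Rightarrow> (real \<Rightarrow> real) \<Rightarrow> real" where
  "Lp_norm p a b g =
     (if p = \<infinity> then Inf {C. AE x in lebesgue_on {a..b}. \<bar>g x\<bar> \<le> C}
      else (integral\<^sup>L (lebesgue_on {a..b}) (\<lambda>x. \<bar>g x\<bar> powr real_of_ereal p))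
              powr (1 / real_of_ereal p))"

text \<open>Hypotheses on f, given through its derivatives D k = f^(k), k = 0..n:
  f^(k) differentiable on [a,b] with derivative f^(k+1) for k < n-1,
  f^(n-1) absolutely continuous on [a,b], with a.e. derivative f^(n), and f^(n) in L^p.\<close>
definition admissible :: "nat \<Rightarrow> ereal \<Rightarrow> real \<Rightarrow> real \<Rightarrow> (nat \<Rightarrow> real \<Rightarrow> real) \<Rightarrow> bool" where
  "admissible n p a b D \<longleftrightarrow>
     (\<forall>k < n - 1. \<forall>x\<in>{a..b}. (D k has_real_derivative D (Suc k) x) (at x within {a..b})) \<and>
     abs_cont_on a b (D (n - 1)) \<and>
     (AE x in lebesgue_on {a..b}. (D (n - 1) has_real_derivative D n x) (at x)) \<and>
     in_Lp p a b (D n)"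

definition monic_deg :: "nat \<Rightarrow> real poly \<Rightarrow> bool" where
  "monic_deg n \<phi> \<longleftrightarrow> degree \<phi> = n \<and> lead_coeff \<phi> = 1"

definition err_term :: "nat \<Rightarrow> real \<Rightarrow> real \<Rightarrow> real poly \<Rightarrow> (nat \<Rightarrow> real \<Rightarrow> real) \<Rightarrow> real" where
  "err_term n a b \<phi> D =
     (-1) ^ n / fact n * integral\<^sup>L (lebesgue_on {a..b}) (\<lambda>x. D n x * poly \<phi> x)"

text \<open>The rescaled polynomial tilde-phi, characterised by
  phi(x) = ((b-a)/2)^n * tilde-phi((2x-a-b)/(b-a)).\<close>
definition tilde_poly :: "nat \<Rightarrow> real \<Rightarrow> real \<Rightarrow> real poly \<Rightarrow> real poly" where
  "tilde_poly n a b \<phi> = smult ((2 / (b - a)) ^ n) (pcompose \<phi> [:(a + b) / 2, (b - a) / 2:])"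

definition K_const :: "nat \<Rightarrow> ereal \<Rightarrow> real poly \<Rightarrow> real" where
  "K_const n q \<psi> = 2 powr (- real n - inv_exp q) * Lp_norm q (-1) 1 (poly \<psi>) / fact n"

end

theory Submission
  imports Defs "HOL-Computational_Algebra.Fundamental_Theorem_Algebra"
begin

text \<open>
  The identity is iterated integration by parts, the last step being the fundamental theorem of
  calculus for absolutely continuous functions; the error bound is Hoelder's inequality.

  For the minimal monic polynomial over \<open>[-1,1]\<close> with \<open>q < \<infinity>\<close>, moving the complex
  roots of a monic polynomial into \<open>[-1,1]\<close> decreases its modulus on \<open>[-1,1]\<close>, so a minimiser
  exists by compactness of the set of root vectors. If there were two, equality would hold in the
  convexity inequality at their midpoint, so both would be bounded by a multiple of one real-rooted
  monic polynomial of the same degree and hence be equal to it; this covers \<open>q = 1\<close> as well.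
  For \<open>q = \<infinity>\<close> the leading coefficient of a polynomial of degree \<open>n\<close> is a combination of its
  values at the \<open>n + 1\<close> extremal points of the Chebyshev polynomial with weights of alternating
  sign, which forces any competitor to agree with the Chebyshev polynomial there.

  Sharpness follows by integrating \<open>n\<close> times a continuous near-extremal function for Hoelder's
  inequality.
\<close>

section \<open>Absolutely continuous functions\<close>

text \<open>The last integration by parts is beyond the ordinary fundamental theorem because
  \<open>D n\<close> is a derivative only almost everywhere; the gauge integral gives integrability
  and value at once. Root vectors rather than coefficient vectors parametrise the competitors since
  they range over a fixed cube, so compactness costs no norm estimate. Uniqueness is delicate at
  both ends of the scale: the \<open>L^1\<close> norm is not strictly convex, so equality at the
  midpoint does not by itself identify two minimisers, and divisibility has to do the rest; for the
  maximum norm such an equality gives no pointwise identity at all, hence a separate argument. In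
  the sharpness part the true extremals fail at the endpoint exponents: for \<open>q = 1\<close> it
  is the sign of \<open>\<phi>\<close>, in general discontinuous, and for
  \<open>q = \<infinity>\<close> a point mass, which is no function. Therefore each constant below
  the norm is beaten by a test function of its own, and its continuity makes the iterated
  antiderivatives differentiable at every point.\<close>

lemma abs_cont_onD:
  assumes "abs_cont_on a b g" "0 < \<epsilon>"
  obtains \<delta> where "0 < \<delta>"
    "\<forall>(S :: 'z set) u v. finite S \<longrightarrow> (\<forall>i\<in>S. a \<le> u i \<and> u i \<le> v i \<and> v i \<le> b) \<longrightarrow>
        (\<forall>i\<in>S. \<forall>j\<in>S. i \<noteq> j \<longrightarrow> v i \<le> u j \<or> v j \<le> u i) \<longrightarrow>
        (\<Sum>i\<in>S. v i - u i) < \<delta> \<longrightarrow> (\<Sum>i\<in>S. \<bar>g (v i) - g (u i)\<bar>) < \<epsilon>"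
proof -
  obtain \<delta> where "0 < \<delta>" and \<delta>:
    "\<forall>(m::nat) u v. (\<forall>i<m. a \<le> u i \<and> u i \<le> v i \<and> v i \<le> b) \<and>
        (\<forall>i<m. \<forall>j<m. i \<noteq> j \<longrightarrow> v i \<le> u j \<or> v j \<le> u i) \<and> (\<Sum>i<m. v i - u i) < \<delta>
        \<longrightarrow> (\<Sum>i<m. \<bar>g (v i) - g (u i)\<bar>) < \<epsilon>"
    using assms(1)[unfolded abs_cont_on_def, THEN spec, THEN mp, OF assms(2)] by blast
  show thesis
  proof (rule that[OF \<open>0 < \<delta>\<close>], intro allI impI)
    fix S :: "'z set" and u v
    assume S: "finite S" "\<forall>i\<in>S. a \<le> u i \<and> u i \<le> v i \<and> v i \<le> b"
        "\<forall>i\<in>S. \<forall>j\<in>S. i \<noteq> j \<longrightarrow> v i \<le> u j \<or> v j \<le> u i"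
        "(\<Sum>i\<in>S. v i - u i) < \<delta>"
    \<comment> \<open>Tagged divisions come indexed by pairs of a tag and an interval, so the
      definition over initial segments of the naturals is carried to \<open>S\<close> along an
      enumeration.\<close>
    obtain h where "bij_betw h {0..<card S} S"
      using ex_bij_betw_nat_finite S(1) by blast
    then have h: "bij_betw h {..<card S} S"
      by (simp add: atLeast0LessThan)
    have hS: "h i \<in> S" if "i < card S" for i
      using h that by (auto simp: bij_betw_def)
    have hne: "h i \<noteq> h j" if "i < card S" "j < card S" "i \<noteq> j" for i j
      using h that by (auto simp: bij_betw_def inj_on_def)
    have "(\<Sum>i<card S. \<bar>g (v (h i)) - g (u (h i))\<bar>) < \<epsilon>"
    proof (rule \<delta>[rule_format], intro conjI allI impI)
      show "(\<Sum>i<card S. v (h i) - u (h i)) < \<delta>"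
        using S(4) sum.reindex_bij_betw[OF h, of "\<lambda>i. v i - u i"] by simp
    qed (use S hS hne in auto)
    then show "(\<Sum>i\<in>S. \<bar>g (v i) - g (u i)\<bar>) < \<epsilon>"
      using sum.reindex_bij_betw[OF h, of "\<lambda>i. \<bar>g (v i) - g (u i)\<bar>"] by simp
  qed
qed

lemma abs_cont_on_imp_continuous_on:
  assumes "abs_cont_on a b g"
  shows "continuous_on {a..b} g"
  unfolding continuous_on_iff
proof (intro ballI allI impI)
  fix x e :: real assume x: "x \<in> {a..b}" and "0 < e"
  obtain \<delta> where "0 < \<delta>" and \<delta>:
    "\<forall>S u v. finite S \<longrightarrow> (\<forall>i\<in>S. a \<le> u i \<and> u i \<le> v i \<and> v i \<le> b) \<longrightarrow>
        (\<forall>i\<in>S. \<forall>j\<in>S. i \<noteq> j \<longrightarrow> v i \<le> u j \<or> v j \<le> u i) \<longrightarrow>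
        (\<Sum>i\<in>S. v i - u i) < \<delta> \<longrightarrow> (\<Sum>i\<in>(S :: unit set). \<bar>g (v i) - g (u i)\<bar>) < e"
    by (rule abs_cont_onD[OF assms \<open>0 < e\<close>, where ?'z=unit])
  have "dist (g y) (g x) < e" if "y \<in> {a..b}" "dist y x < \<delta>" for y
  proof -
    have "\<bar>g (max x y) - g (min x y)\<bar> < e"
      using \<delta>[rule_format, of "{()}" "\<lambda>_. min x y" "\<lambda>_. max x y"] x that
      by (auto simp: dist_real_def)
    then show ?thesis
      by (cases "x \<le> y") (auto simp: dist_real_def min_def max_def)
  qed
  with \<open>0 < \<delta>\<close> show "\<exists>d>0. \<forall>y\<in>{a..b}. dist y x < d \<longrightarrow> dist (g y) (g x) < e"
    by blast
qed

lemma lipschitz_imp_abs_cont_on: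
  assumes "\<And>x y. \<lbrakk>x \<in> {a..b}; y \<in> {a..b}\<rbrakk> \<Longrightarrow> \<bar>g y - g x\<bar> \<le> L * \<bar>y - x\<bar>" "0 \<le> L"
  shows "abs_cont_on a b g"
  unfolding abs_cont_on_def
proof (intro allI impI)
  fix \<epsilon> :: real assume "0 < \<epsilon>"
  show "\<exists>\<delta>>0. \<forall>(m::nat) u v. (\<forall>i<m. a \<le> u i \<and> u i \<le> v i \<and> v i \<le> b) \<and>
        (\<forall>i<m. \<forall>j<m. i \<noteq> j \<longrightarrow> v i \<le> u j \<or> v j \<le> u i) \<and> (\<Sum>i<m. v i - u i) < \<delta>
        \<longrightarrow> (\<Sum>i<m. \<bar>g (v i) - g (u i)\<bar>) < \<epsilon>"
  proof (intro exI[of _ "\<epsilon> / (L + 1)"] conjI allI impI)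
    show "0 < \<epsilon> / (L + 1)" using \<open>0 < \<epsilon>\<close> assms(2) by simp
    fix m :: nat and u v :: "nat \<Rightarrow> real"
    assume *: "(\<forall>i<m. a \<le> u i \<and> u i \<le> v i \<and> v i \<le> b) \<and>
        (\<forall>i<m. \<forall>j<m. i \<noteq> j \<longrightarrow> v i \<le> u j \<or> v j \<le> u i) \<and> (\<Sum>i<m. v i - u i) < \<epsilon> / (L + 1)"
    have "(\<Sum>i<m. \<bar>g (v i) - g (u i)\<bar>) \<le> (\<Sum>i<m. L * (v i - u i))"
    proof (rule sum_mono)
      fix i assume "i \<in> {..<m}"
      then have "a \<le> u i" "u i \<le> v i" "v i \<le> b" using * by auto
      then show "\<bar>g (v i) - g (u i)\<bar> \<le> L * (v i - u i)"
        using assms(1)[of "u i" "v i"] by auto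
    qed
    also have "\<dots> \<le> (L + 1) * (\<Sum>i<m. v i - u i)"
      unfolding sum_distrib_left[symmetric]
      by (intro mult_right_mono sum_nonneg) (use * in auto)
    also have "\<dots> < \<epsilon>"
      using * assms(2) by (simp add: pos_less_divide_eq mult.commute)
    finally show "(\<Sum>i<m. \<bar>g (v i) - g (u i)\<bar>) < \<epsilon>" .
  qed
qed

lemma continuous_on_Icc_bounded:
  fixes g :: "real \<Rightarrow> real"
  assumes "continuous_on {a..b} g"
  obtains M where "0 \<le> M" "\<And>x. x \<in> {a..b} \<Longrightarrow> \<bar>g x\<bar> \<le> M"
proof -
  obtain M where "0 < M" "\<forall>x\<in>g ` {a..b}. norm x \<le> M"
    using compact_imp_bounded[OF compact_continuous_image[OF assms compact_Icc]]
    unfolding bounded_pos by blast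
  then show thesis by (intro that[of M]) auto
qed

text \<open>Made for the derivative of order \<open>n - 1\<close> times a polynomial, which is
  Lipschitz on the interval. An increment of the product splits into one of \<open>g\<close>,
  weighted by a bound of \<open>h\<close>, and one of \<open>h\<close>, charged to the
  length.\<close>

lemma abs_cont_on_mult_lipschitz:
  assumes g: "abs_cont_on a b g"
    and h: "\<And>x y. \<lbrakk>x \<in> {a..b}; y \<in> {a..b}\<rbrakk> \<Longrightarrow> \<bar>h y - h x\<bar> \<le> L * \<bar>y - x\<bar>" "0 \<le> L"
  shows "abs_cont_on a b (\<lambda>x. g x * h x)"
  unfolding abs_cont_on_def
proof (intro allI impI)
  have conth: "continuous_on {a..b} h"
    using lipschitz_imp_abs_cont_on[OF h] by (simp add: abs_cont_on_imp_continuous_on)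
  obtain M where M: "0 \<le> M" "\<And>x. x \<in> {a..b} \<Longrightarrow> \<bar>g x\<bar> \<le> M"
    by (rule continuous_on_Icc_bounded[OF abs_cont_on_imp_continuous_on[OF g]]) blast
  obtain P where P: "0 \<le> P" "\<And>x. x \<in> {a..b} \<Longrightarrow> \<bar>h x\<bar> \<le> P"
    by (rule continuous_on_Icc_bounded[OF conth]) blast
  fix \<epsilon> :: real assume "0 < \<epsilon>"
  then have eP: "0 < \<epsilon> / (2 * (P + 1))" using P(1) by simp
  obtain \<delta> where "0 < \<delta>" and \<delta>:
    "\<forall>(m::nat) u v. (\<forall>i<m. a \<le> u i \<and> u i \<le> v i \<and> v i \<le> b) \<and>
        (\<forall>i<m. \<forall>j<m. i \<noteq> j \<longrightarrow> v i \<le> u j \<or> v j \<le> u i) \<and> (\<Sum>i<m. v i - u i) < \<delta>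
        \<longrightarrow> (\<Sum>i<m. \<bar>g (v i) - g (u i)\<bar>) < \<epsilon> / (2 * (P + 1))"
    using g[unfolded abs_cont_on_def, THEN spec, THEN mp, OF eP] by blast
  \<comment> \<open>The increments of \<open>g\<close> and those of \<open>h\<close> each get half
    of \<open>\<epsilon>\<close>; the added 1 keeps the denominator positive.\<close>
  define \<eta> where "\<eta> = min \<delta> (\<epsilon> / (2 * (M * L + 1)))"
  have ML0: "0 \<le> M * L" using M(1) h(2) by simp
  show "\<exists>\<delta>>0. \<forall>(m::nat) u v. (\<forall>i<m. a \<le> u i \<and> u i \<le> v i \<and> v i \<le> b) \<and>
        (\<forall>i<m. \<forall>j<m. i \<noteq> j \<longrightarrow> v i \<le> u j \<or> v j \<le> u i) \<and> (\<Sum>i<m. v i - u i) < \<delta>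
        \<longrightarrow> (\<Sum>i<m. \<bar>g (v i) * h (v i) - g (u i) * h (u i)\<bar>) < \<epsilon>"
  proof (intro exI[of _ \<eta>] conjI allI impI)
    show "0 < \<eta>" unfolding \<eta>_def using \<open>0 < \<delta>\<close> \<open>0 < \<epsilon>\<close> ML0 by simp
    fix m :: nat and u v :: "nat \<Rightarrow> real"
    assume *: "(\<forall>i<m. a \<le> u i \<and> u i \<le> v i \<and> v i \<le> b) \<and>
        (\<forall>i<m. \<forall>j<m. i \<noteq> j \<longrightarrow> v i \<le> u j \<or> v j \<le> u i) \<and> (\<Sum>i<m. v i - u i) < \<eta>"
    have less: "(\<Sum>i<m. \<bar>g (v i) - g (u i)\<bar>) < \<epsilon> / (2 * (P + 1))"
      by (rule \<delta>[rule_format]) (use * in \<open>auto simp: \<eta>_def\<close>)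
    have "(\<Sum>i<m. \<bar>g (v i) * h (v i) - g (u i) * h (u i)\<bar>)
        \<le> (\<Sum>i<m. (P + 1) * \<bar>g (v i) - g (u i)\<bar> + (M * L + 1) * (v i - u i))"
    proof (rule sum_mono)
      fix i assume "i \<in> {..<m}"
      then have i: "a \<le> u i" "u i \<le> v i" "v i \<le> b" using * by auto
      have "g (v i) * h (v i) - g (u i) * h (u i)
          = (g (v i) - g (u i)) * h (v i) + g (u i) * (h (v i) - h (u i))"
        by (simp add: algebra_simps)
      then have "\<bar>g (v i) * h (v i) - g (u i) * h (u i)\<bar>
          \<le> \<bar>g (v i) - g (u i)\<bar> * \<bar>h (v i)\<bar> + \<bar>g (u i)\<bar> * \<bar>h (v i) - h (u i)\<bar>"
        by (metis abs_mult abs_triangle_ineq)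
      also have "\<dots> \<le> \<bar>g (v i) - g (u i)\<bar> * (P + 1) + M * (L * (v i - u i))"
        using i P(2)[of "v i"] M(2)[of "u i"] h(1)[of "u i" "v i"] M(1) h(2)
        by (intro add_mono mult_mono) auto
      also have "\<dots> \<le> (P + 1) * \<bar>g (v i) - g (u i)\<bar> + (M * L + 1) * (v i - u i)"
        using i by (simp add: algebra_simps)
      finally show "\<bar>g (v i) * h (v i) - g (u i) * h (u i)\<bar>
          \<le> (P + 1) * \<bar>g (v i) - g (u i)\<bar> + (M * L + 1) * (v i - u i)" .
    qed
    also have "\<dots> = (P + 1) * (\<Sum>i<m. \<bar>g (v i) - g (u i)\<bar>) + (M * L + 1) * (\<Sum>i<m. v i - u i)"
      by (simp add: sum.distrib sum_distrib_left)
    also have "\<dots> < \<epsilon> / 2 + \<epsilon> / 2"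
    proof (rule add_strict_mono)
      show "(P + 1) * (\<Sum>i<m. \<bar>g (v i) - g (u i)\<bar>) < \<epsilon> / 2"
        using less P(1) by (simp add: field_simps)
      have "(\<Sum>i<m. v i - u i) < \<epsilon> / (2 * (M * L + 1))"
        using * unfolding \<eta>_def by auto
      then show "(M * L + 1) * (\<Sum>i<m. v i - u i) < \<epsilon> / 2"
        using ML0 by (simp add: field_simps)
    qed
    finally show "(\<Sum>i<m. \<bar>g (v i) * h (v i) - g (u i) * h (u i)\<bar>) < \<epsilon>" by simp
  qed
qed

lemma tagged_partial_division_abs_cont:
  assumes g: "abs_cont_on a b g" and "0 < \<epsilon>"
  obtains \<delta> where "0 < \<delta>"
    "\<forall>p. p tagged_partial_division_of {a..b} \<longrightarrow> (\<Sum>(x,K)\<in>p. measure lborel K) < \<delta>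
        \<longrightarrow> (\<Sum>(x,K)\<in>p. \<bar>g (Sup K) - g (Inf K)\<bar>) < \<epsilon>"
proof -
  obtain \<delta> where "0 < \<delta>" and \<delta>:
    "\<forall>S u v. finite S \<longrightarrow> (\<forall>i\<in>S. a \<le> u i \<and> u i \<le> v i \<and> v i \<le> b) \<longrightarrow>
        (\<forall>i\<in>S. \<forall>j\<in>S. i \<noteq> j \<longrightarrow> v i \<le> u j \<or> v j \<le> u i) \<longrightarrow>
        (\<Sum>i\<in>S. v i - u i) < \<delta> \<longrightarrow> (\<Sum>i\<in>(S :: (real \<times> real set) set). \<bar>g (v i) - g (u i)\<bar>) < \<epsilon>"
    by (rule abs_cont_onD[OF g \<open>0 < \<epsilon>\<close>, where ?'z="real \<times> real set"])
  show thesis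
  proof (rule that[OF \<open>0 < \<delta>\<close>], intro allI impI)
    fix p assume p: "p tagged_partial_division_of {a..b}" and small: "(\<Sum>(x,K)\<in>p. measure lborel K) < \<delta>"
    \<comment> \<open>One-point intervals have empty interior and may lie inside another interval of
      the division, against the ordering that absolute continuity asks for. They contribute nothing
      to the sums and are dropped.\<close>
    define S where "S = {i \<in> p. Inf (snd i) < Sup (snd i)}"
    have fin: "finite p" using p by (rule tagged_partial_division_ofD)
    have intv: "\<exists>u v. snd i = {u..v} \<and> u \<le> v \<and> a \<le> u \<and> v \<le> b" if "i \<in> p" for i
    proof -
      obtain x K where i: "i = (x, K)" by fastforce
      have "(x, K) \<in> p" using that i by simp
      from tagged_partial_division_ofD(4)[OF p this] obtain u v where K: "K = cbox u v" by blast
      have "x \<in> K" "K \<subseteq> {a..b}"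
        using tagged_partial_division_ofD(2,3)[OF p] that i by auto
      with K i show ?thesis by auto
    qed
    have cont: "measure lborel (snd i) = Sup (snd i) - Inf (snd i)" if "i \<in> p" for i
      using intv[OF that] by auto
    have "(\<Sum>(x,K)\<in>p. \<bar>g (Sup K) - g (Inf K)\<bar>) = (\<Sum>i\<in>p. \<bar>g (Sup (snd i)) - g (Inf (snd i))\<bar>)"
      by (simp add: case_prod_unfold)
    also have "\<dots> = (\<Sum>i\<in>S. \<bar>g (Sup (snd i)) - g (Inf (snd i))\<bar>)"
    proof (rule sum.mono_neutral_right[OF fin])
      show "\<forall>i\<in>p - S. \<bar>g (Sup (snd i)) - g (Inf (snd i))\<bar> = 0"
      proof
        fix i assume i: "i \<in> p - S"
        then obtain u v where "snd i = {u..v}" "u \<le> v" using intv by blast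
        with i show "\<bar>g (Sup (snd i)) - g (Inf (snd i))\<bar> = 0" by (auto simp: S_def)
      qed
    qed (auto simp: S_def)
    also have "\<dots> < \<epsilon>"
    proof (rule \<delta>[rule_format, where u="\<lambda>i. Inf (snd i)" and v="\<lambda>i. Sup (snd i)"])
      show "finite S" using fin by (simp add: S_def)
      show "a \<le> Inf (snd i) \<and> Inf (snd i) \<le> Sup (snd i) \<and> Sup (snd i) \<le> b" if "i \<in> S" for i
        using intv[of i] that by (auto simp: S_def)
      show "Sup (snd i) \<le> Inf (snd j) \<or> Sup (snd j) \<le> Inf (snd i)" if ij: "i \<in> S" "j \<in> S" "i \<noteq> j" for i j
      proof -
        obtain u v where uv: "snd i = {u..v}" "u < v" using intv[of i] ij by (auto simp: S_def)
        obtain w z where wz: "snd j = {w..z}" "w < z" using intv[of j] ij by (auto simp: S_def)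
        have "(fst i, snd i) \<in> p" "(fst j, snd j) \<in> p" "(fst i, snd i) \<noteq> (fst j, snd j)"
          using ij by (auto simp: S_def)
        then have "interior (snd i) \<inter> interior (snd j) = {}"
          using tagged_partial_division_ofD(5)[OF p, of "fst i" "snd i" "fst j" "snd j"] by simp
        then have disj: "{u<..<v} \<inter> {w<..<z} = {}"
          by (simp only: uv(1) wz(1) interior_atLeastAtMost_real)
        have "\<not> max u w < min v z"
        proof
          assume "max u w < min v z"
          then obtain t where "max u w < t" "t < min v z" using dense by blast
          then have "t \<in> {u<..<v} \<inter> {w<..<z}" by simp
          with disj show False by blast
        qed
        then have "v \<le> w \<or> z \<le> u" using uv(2) wz(2) by linarith
        then show ?thesis using uv wz by simp
      qed
      have "(\<Sum>i\<in>S. Sup (snd i) - Inf (snd i)) = (\<Sum>i\<in>S. measure lborel (snd i))"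
        using cont by (intro sum.cong) (auto simp: S_def)
      also have "\<dots> \<le> (\<Sum>i\<in>p. measure lborel (snd i))"
        by (rule sum_mono2[OF fin]) (auto simp: S_def)
      finally show "(\<Sum>i\<in>S. Sup (snd i) - Inf (snd i)) < \<delta>"
        using small by (simp add: case_prod_unfold)
    qed
    finally show "(\<Sum>(x,K)\<in>p. \<bar>g (Sup K) - g (Inf K)\<bar>) < \<epsilon>" .
  qed
qed

lemma tagged_partial_division_content_le:
  fixes U :: "real set"
  assumes p: "p tagged_partial_division_of {a..b}" and sub: "\<And>x K. (x,K) \<in> p \<Longrightarrow> K \<subseteq> U"
    and U: "U \<in> lmeasurable"
  shows "(\<Sum>(x,K)\<in>p. measure lborel K) \<le> measure lebesgue U"
proof -
  note q = tagged_partial_division_of_Union_self[OF p]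
  have d: "snd ` p division_of \<Union>(snd ` p)"
    by (rule division_of_tagged_division[OF q])
  \<comment> \<open>Two tags can carry the same set only if its interior is empty, so passing from
    pairs to sets loses no content.\<close>
  have "(\<Sum>(x,K)\<in>p. measure lborel K) = (\<Sum>K\<in>snd ` p. measure lborel K)"
    by (rule sum.over_tagged_division_lemma[OF q]) (simp add: content_eq_0_interior)
  also have "\<dots> = (\<Sum>K\<in>snd ` p. measure lebesgue K)"
  proof (intro sum.cong refl)
    fix K assume "K \<in> snd ` p"
    then obtain u v where "K = cbox u v" using division_ofD(4)[OF d] by blast
    then show "measure lborel K = measure lebesgue K" by simp
  qed
  also have "\<dots> = measure lebesgue (\<Union>(snd ` p))"
    using d by (rule content_division)
  also have "\<dots> \<le> measure lebesgue U"
  proof (rule measure_mono_fmeasurable)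
    show "\<Union>(snd ` p) \<subseteq> U" using sub by fastforce
    show "\<Union>(snd ` p) \<in> sets lebesgue" using d by (intro fmeasurableD lmeasurable_division)
  qed (rule U)
  finally show ?thesis .
qed

text \<open>The Henstock-Kurzweil form needs no integrability of the derivative: tags in the
  exceptional null set are confined to an open set so small that absolute continuity controls
  their contribution, all other tags are handled by differentiability.\<close>
theorem fundamental_theorem_abs_cont:
  assumes "a \<le> b" and g: "abs_cont_on a b g" and N: "negligible N"
    and deriv: "\<And>x. x \<in> {a..b} - N \<Longrightarrow> (g has_real_derivative h x) (at x within {a..b})"
  shows "(h has_integral (g b - g a)) {a..b}"
proof (rule has_integral_spike[OF N])
  \<comment> \<open>With the integrand 0 on \<open>N\<close>, tags in \<open>N\<close> contribute
    only increments of \<open>g\<close>.\<close>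
  define h' where "h' = (\<lambda>x. if x \<in> N then 0 else h x)"
  show "\<And>x. x \<in> {a..b} - N \<Longrightarrow> h x = h' x" by (simp add: h'_def)
  show "(h' has_integral (g b - g a)) {a..b}"
    unfolding has_integral_real
  proof (intro allI impI)
    fix e :: real assume "0 < e"
    \<comment> \<open>The tags outside \<open>N\<close> produce a total error of at most
      \<open>e1 * (b - a)\<close>, hence at most \<open>e / 2\<close>; the added 1 covers
      \<open>a = b\<close>.\<close>
    define e1 where "e1 = e / (2 * (b - a + 1))"
    have "0 < e1" using \<open>0 < e\<close> \<open>a \<le> b\<close> by (simp add: e1_def)
    have "\<exists>d>0. x \<in> {a..b} - N \<longrightarrow>
        (\<forall>y\<in>{a..b}. \<bar>y - x\<bar> < d \<longrightarrow> \<bar>g y - g x - h x * (y - x)\<bar> \<le> e1 * \<bar>y - x\<bar>)" for x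
    proof (cases "x \<in> {a..b} - N")
      case True
      from deriv[OF this, unfolded has_field_derivative_def has_derivative_within_alt real_norm_def]
        \<open>0 < e1\<close> show ?thesis by blast
    qed (auto intro: exI[of _ 1])
    then obtain d where d: "\<And>x. 0 < d x"
      "\<forall>x. x \<in> {a..b} - N \<longrightarrow> (\<forall>y\<in>{a..b}. \<bar>y - x\<bar> < d x \<longrightarrow>
          \<bar>g y - g x - h x * (y - x)\<bar> \<le> e1 * \<bar>y - x\<bar>)"
      by metis
    have "0 < e / 2" using \<open>0 < e\<close> by simp
    from tagged_partial_division_abs_cont[OF g this]
    obtain \<delta> where "0 < \<delta>" and \<delta>:
      "\<forall>p. p tagged_partial_division_of {a..b} \<longrightarrow> (\<Sum>(x,K)\<in>p. measure lborel K) < \<delta>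
          \<longrightarrow> (\<Sum>(x,K)\<in>p. \<bar>g (Sup K) - g (Inf K)\<bar>) < e / 2"
      by blast
    have "N \<in> lmeasurable" and N0: "measure lebesgue N = 0"
      using N by (auto simp: negligible_imp_measurable negligible_imp_measure0)
    then obtain U where U: "open U" "N \<subseteq> U" "U - N \<in> lmeasurable" "emeasure lebesgue (U - N) < ennreal \<delta>"
      using sets_lebesgue_outer_open[of N \<delta>] \<open>0 < \<delta>\<close> by (metis fmeasurableD)
    have Um: "U \<in> lmeasurable"
      using U(2,3) \<open>N \<in> lmeasurable\<close> by (metis Diff_partition fmeasurable.Un)
    have "measure lebesgue U = measure lebesgue (U - N)"
      using N by (simp add: measure_Diff_null_set negligible_iff_null_sets Um fmeasurableD)
    also have "\<dots> < \<delta>"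
      using U(3,4) \<open>0 < \<delta>\<close> by (simp add: emeasure_eq_measure2 ennreal_less_iff)
    finally have U\<delta>: "measure lebesgue U < \<delta>" .
    define \<gamma> where "\<gamma> = (\<lambda>x. if x \<in> N then U else ball x (d x))"
    have gauge: "gauge \<gamma>"
      using U(1,2) d(1) by (auto simp: gauge_def \<gamma>_def)
    have "norm ((\<Sum>(x,K)\<in>p. measure lborel K *\<^sub>R h' x) - (g b - g a)) < e"
      if p: "p tagged_division_of {a..b}" and fine: "\<gamma> fine p" for p
    proof -
      define q where "q = {i \<in> p. fst i \<in> N}"
      have fin: "finite p" using p by (rule tagged_division_ofD(1))
      define T where "T = (\<lambda>i. case i of (x::real,K) \<Rightarrow> measure lborel K *\<^sub>R h' x - (g (Sup K) - g (Inf K)))"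
      have ba: "b - a = (\<Sum>(x,K)\<in>p. Sup K - Inf K)" "g b - g a = (\<Sum>(x,K)\<in>p. g (Sup K) - g (Inf K))"
        using additive_tagged_division_1[OF \<open>a \<le> b\<close> p, of "\<lambda>x. x"]
          additive_tagged_division_1[OF \<open>a \<le> b\<close> p, of g] by simp_all
      have intv: "\<exists>u v. K = {u..v} \<and> u \<le> v \<and> a \<le> u \<and> v \<le> b \<and> x \<in> K" if xK: "(x,K) \<in> p" for x K
      proof -
        obtain u v where "K = cbox u v" using tagged_division_ofD(4)[OF p xK] by blast
        moreover have "x \<in> K" "K \<subseteq> {a..b}" using tagged_division_ofD(2,3)[OF p xK] .
        ultimately show ?thesis by auto
      qed
      have "(\<Sum>(x,K)\<in>p. measure lborel K *\<^sub>R h' x) - (g b - g a) = sum T p"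
        unfolding ba(2) T_def by (simp add: sum_subtractf case_prod_unfold)
      also have "\<dots> = sum T (p - q) + sum T q"
        by (rule sum.subset_diff) (auto simp: q_def fin)
      finally have "\<bar>(\<Sum>(x,K)\<in>p. measure lborel K *\<^sub>R h' x) - (g b - g a)\<bar> \<le> \<bar>sum T (p - q)\<bar> + \<bar>sum T q\<bar>"
        by simp
      moreover have "\<bar>sum T q\<bar> < e / 2"
      proof -
        have q: "q tagged_partial_division_of {a..b}"
          using p by (auto simp: q_def tagged_division_of_def intro: tagged_partial_division_subset)
        have "\<bar>sum T q\<bar> \<le> (\<Sum>i\<in>q. \<bar>T i\<bar>)" by (rule sum_abs)
        also have "\<dots> = (\<Sum>(x,K)\<in>q. \<bar>g (Sup K) - g (Inf K)\<bar>)"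
          by (intro sum.cong) (auto simp: T_def q_def h'_def)
        also have "\<dots> < e / 2"
        proof (rule \<delta>[rule_format, OF q])
          have "(\<Sum>(x,K)\<in>q. measure lborel K) \<le> measure lebesgue U"
          proof (rule tagged_partial_division_content_le[OF q _ Um])
            show "K \<subseteq> U" if "(x,K) \<in> q" for x K
              using fine that unfolding fine_def \<gamma>_def q_def by fastforce
          qed
          with U\<delta> show "(\<Sum>(x,K)\<in>q. measure lborel K) < \<delta>" by linarith
        qed
        finally show ?thesis .
      qed
      moreover have "\<bar>sum T (p - q)\<bar> \<le> e / 2"
      proof -
        have "\<bar>sum T (p - q)\<bar> \<le> (\<Sum>i\<in>p - q. \<bar>T i\<bar>)" by (rule sum_abs)
        also have "\<dots> \<le> (\<Sum>i\<in>p - q. e1 * (Sup (snd i) - Inf (snd i)))"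
        proof (rule sum_mono)
          fix i assume i: "i \<in> p - q"
          obtain x K where xK: "i = (x,K)" by fastforce
          with i have "(x,K) \<in> p" "x \<notin> N" by (auto simp: q_def)
          from intv[OF this(1)] obtain u v where uv: "K = {u..v}" "u \<le> v" "a \<le> u" "v \<le> b" "u \<le> x" "x \<le> v"
            by auto
          have "K \<subseteq> ball x (d x)"
            using fineD[OF fine \<open>(x,K) \<in> p\<close>] \<open>x \<notin> N\<close> by (simp add: \<gamma>_def)
          then have "u \<in> ball x (d x)" "v \<in> ball x (d x)"
            using uv(1,2) by auto
          then have "\<bar>u - x\<bar> < d x" "\<bar>v - x\<bar> < d x"
            by (simp_all add: dist_real_def abs_minus_commute)
          then have "\<bar>g u - g x - h x * (u - x)\<bar> \<le> e1 * \<bar>u - x\<bar>" "\<bar>g v - g x - h x * (v - x)\<bar> \<le> e1 * \<bar>v - x\<bar>"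
            using uv \<open>x \<notin> N\<close> by (intro d(2)[rule_format]; auto)+
          \<comment> \<open>Subtracting the linear approximations at both endpoints leaves the
            increment over the interval. As the tag lies between them, the two errors add up to
            \<open>e1\<close> times the length.\<close>
          moreover have "\<bar>T i\<bar> = \<bar>(g v - g x - h x * (v - x)) - (g u - g x - h x * (u - x))\<bar>"
            using uv \<open>x \<notin> N\<close> by (simp add: T_def xK h'_def algebra_simps)
          ultimately have "\<bar>T i\<bar> \<le> e1 * \<bar>v - x\<bar> + e1 * \<bar>u - x\<bar>" by linarith
          also have "\<dots> = e1 * (v - u)" using uv by (simp add: algebra_simps)
          finally show "\<bar>T i\<bar> \<le> e1 * (Sup (snd i) - Inf (snd i))"
            using uv xK by simp
        qed
        also have "\<dots> \<le> (\<Sum>i\<in>p. e1 * (Sup (snd i) - Inf (snd i)))"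
        proof (rule sum_mono2[OF fin])
          fix i assume "i \<in> p - (p - q)"
          then show "0 \<le> e1 * (Sup (snd i) - Inf (snd i))"
            using intv[of "fst i" "snd i"] \<open>0 < e1\<close> by auto
        qed auto
        also have "\<dots> = e1 * (b - a)"
          unfolding ba(1) by (simp add: sum_distrib_left case_prod_unfold)
        also have "\<dots> \<le> e / 2"
          using \<open>0 < e\<close> \<open>a \<le> b\<close> by (simp add: e1_def field_simps)
        finally show ?thesis .
      qed
      ultimately show ?thesis unfolding real_norm_def by linarith
    qed
    with gauge show "\<exists>\<gamma>. gauge \<gamma> \<and> (\<forall>\<D>. \<D> tagged_division_of {a..b} \<and> \<gamma> fine \<D> \<longrightarrow>
        norm ((\<Sum>(x,k)\<in>\<D>. measure lborel k *\<^sub>R h' x) - (g b - g a)) < e)"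
      by (intro exI[of _ \<gamma>]) simp
  qed
qed

section \<open>Integration by parts and the quadrature identity\<close>

lemma AE_lebesgue_onE:
  assumes "AE x in lebesgue_on S. P x" "S \<in> sets lebesgue"
  obtains N where "negligible N" "\<And>x. x \<in> S - N \<Longrightarrow> P x"
proof -
  have "AE x in lebesgue. x \<in> S \<longrightarrow> P x"
    using assms by (simp add: AE_restrict_space_iff)
  then obtain N where "N \<in> null_sets lebesgue" "{x. \<not> (x \<in> S \<longrightarrow> P x)} \<subseteq> N"
    unfolding eventually_ae_filter by auto
  then show thesis
    by (intro that[of N]) (auto simp: negligible_iff_null_sets)
qed

lemma poly_lipschitz_on_Icc:
  fixes \<phi> :: "real poly"
  obtains L where "0 \<le> L" "\<And>x y. \<lbrakk>x \<in> {a..b}; y \<in> {a..b}\<rbrakk> \<Longrightarrow> \<bar>poly \<phi> y - poly \<phi> x\<bar> \<le> L * \<bar>y - x\<bar>"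
proof -
  obtain L where L: "0 \<le> L" "\<And>x. x \<in> {a..b} \<Longrightarrow> \<bar>poly (pderiv \<phi>) x\<bar> \<le> L"
    by (rule continuous_on_Icc_bounded[of a b "poly (pderiv \<phi>)"]) (auto intro!: continuous_intros)
  show thesis
  proof (rule that[OF L(1)])
    fix x y assume xy: "x \<in> {a..b}" "y \<in> {a..b}"
    have "norm (poly \<phi> y - poly \<phi> x) \<le> L * norm (y - x)"
    proof (rule field_differentiable_bound[of "{a..b}" "poly \<phi>" "poly (pderiv \<phi>)"])
      show "(poly \<phi> has_field_derivative poly (pderiv \<phi>) z) (at z within {a..b})" for z
        by (rule DERIV_subset[OF poly_DERIV]) simp
    qed (use L xy in auto)
    then show "\<bar>poly \<phi> y - poly \<phi> x\<bar> \<le> L * \<bar>y - x\<bar>" by simp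
  qed
qed

lemma continuous_on_admissible:
  assumes "admissible n p a b D" "k < n"
  shows "continuous_on {a..b} (D k)"
proof (cases "k < n - 1")
  case True
  then show ?thesis
    using assms by (auto simp: admissible_def intro!: DERIV_continuous_on)
next
  case False
  with assms(2) have "k = n - 1" by simp
  with assms show ?thesis
    by (auto simp: admissible_def intro: abs_cont_on_imp_continuous_on)
qed

text \<open>Below level \<open>n - 1\<close> the derivatives exist everywhere on the interval; at
  level \<open>n - 1\<close> they exist almost everywhere, and absolute continuity takes over. Both
  summands stay under one integral, so neither has to be shown integrable alone.\<close>

lemma admissible_by_parts:
  assumes adm: "admissible n p a b D" and "a < b" "k < n"
  shows "((\<lambda>x. D (Suc k) x * poly \<psi> x + D k x * poly (pderiv \<psi>) x) has_integral
           (D k b * poly \<psi> b - D k a * poly \<psi> a)) {a..b}"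
proof (cases "k < n - 1")
  case True
  have "((\<lambda>x. D k x * poly \<psi> x) has_vector_derivative
      D (Suc k) x * poly \<psi> x + D k x * poly (pderiv \<psi>) x) (at x within {a..b})" if "x \<in> {a..b}" for x
  proof -
    have "(D k has_real_derivative D (Suc k) x) (at x within {a..b})"
      using adm True that by (auto simp: admissible_def)
    moreover have "(poly \<psi> has_real_derivative poly (pderiv \<psi>) x) (at x within {a..b})"
      by (rule DERIV_subset[OF poly_DERIV]) simp
    ultimately show ?thesis
      unfolding has_real_derivative_iff_has_vector_derivative[symmetric]
      by (rule DERIV_mult[THEN DERIV_cong]) simp
  qed
  then show ?thesis
    using \<open>a < b\<close> by (intro fundamental_theorem_of_calculus) auto
next
  case False
  with assms(3) have k: "k = n - 1" "Suc k = n" by auto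
  obtain N where N: "negligible N" "\<And>x. x \<in> {a..b} - N \<Longrightarrow> (D k has_real_derivative D n x) (at x)"
    by (rule AE_lebesgue_onE[of "\<lambda>x. (D k has_real_derivative D n x) (at x)" "{a..b}"])
      (use adm k in \<open>auto simp: admissible_def\<close>)
  obtain L where L: "0 \<le> L"
    "\<And>x y. \<lbrakk>x \<in> {a..b}; y \<in> {a..b}\<rbrakk> \<Longrightarrow> \<bar>poly \<psi> y - poly \<psi> x\<bar> \<le> L * \<bar>y - x\<bar>"
    by (rule poly_lipschitz_on_Icc[of a b \<psi>]) blast
  have "abs_cont_on a b (\<lambda>x. D k x * poly \<psi> x)"
    using adm k L by (intro abs_cont_on_mult_lipschitz[of a b "D k" "poly \<psi>" L]) (auto simp: admissible_def)
  moreover have "((\<lambda>x. D k x * poly \<psi> x) has_real_derivative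
      D (Suc k) x * poly \<psi> x + D k x * poly (pderiv \<psi>) x) (at x within {a..b})"
    if "x \<in> {a..b} - N" for x
  proof -
    have "(D k has_real_derivative D (Suc k) x) (at x within {a..b})"
      using N(2)[OF that] k by (auto intro: DERIV_subset)
    moreover have "(poly \<psi> has_real_derivative poly (pderiv \<psi>) x) (at x within {a..b})"
      by (rule DERIV_subset[OF poly_DERIV]) simp
    ultimately show ?thesis
      by (rule DERIV_mult[THEN DERIV_cong]) simp
  qed
  ultimately show ?thesis
    using \<open>a < b\<close> N(1) by (intro fundamental_theorem_abs_cont[of a b _ N]) auto
qed

lemma admissible_iterated_by_parts:
  assumes adm: "admissible n p a b D" and ab: "a < b" and "j \<le> n"
  shows "((\<lambda>x. D n x * poly \<phi> x - (-1) ^ j * (D (n - j) x * poly ((pderiv ^^ j) \<phi>) x)) has_integral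
           (\<Sum>i<j. (-1) ^ i * (poly ((pderiv ^^ i) \<phi>) b * D (n - Suc i) b
                              - poly ((pderiv ^^ i) \<phi>) a * D (n - Suc i) a))) {a..b}"
  using \<open>j \<le> n\<close>
proof (induction j)
  case (Suc j)
  define \<psi> where "\<psi> = (pderiv ^^ j) \<phi>"
  have n: "Suc (n - Suc j) = n - j" using Suc by simp
  have "((\<lambda>x. D (n - j) x * poly \<psi> x + D (n - Suc j) x * poly (pderiv \<psi>) x) has_integral
      (D (n - Suc j) b * poly \<psi> b - D (n - Suc j) a * poly \<psi> a)) {a..b}"
    using admissible_by_parts[OF adm ab, of "n - Suc j" \<psi>] Suc n by simp
  \<comment> \<open>The new identity, weighted by \<open>(-1) ^ j\<close>, cancels the term with
    \<open>D (n - j)\<close> and leaves the one with \<open>D (n - Suc j)\<close> and opposite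
    sign.\<close>
  from has_integral_add[OF Suc.IH has_integral_mult_right[OF this, of "(-1)^j"]] Suc.prems
  show ?case
    by (simp add: \<psi>_def algebra_simps)
qed simp

text \<open>The origin of the factor \<open>fact n\<close>: for a monic polynomial it is all that
  remains beside \<open>D 0\<close> after \<open>n\<close> integrations by parts.\<close>

lemma pderiv_funpow_degree:
  fixes \<phi> :: "real poly"
  assumes "degree \<phi> = n"
  shows "(pderiv ^^ n) \<phi> = [:fact n * lead_coeff \<phi>:]"
  using assms
proof (induction n arbitrary: \<phi>)
  case 0
  then show ?case by (auto elim: degree_eq_zeroE)
next
  case (Suc n)
  then have d: "degree (pderiv \<phi>) = n" by (simp add: degree_pderiv)
  have "(pderiv ^^ Suc n) \<phi> = [:fact n * lead_coeff (pderiv \<phi>):]"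
    using Suc.IH[OF d] by (simp add: funpow_swap1)
  also have "lead_coeff (pderiv \<phi>) = of_nat (Suc n) * lead_coeff \<phi>"
    unfolding d using Suc.prems by (simp add: coeff_pderiv)
  finally show ?case by (simp add: algebra_simps)
qed

text \<open>On an interval of finite measure \<open>1 + \<bar>g\<bar> powr r\<close> is integrable
  and dominates \<open>\<bar>g\<bar>\<close>; for \<open>p = \<infinity>\<close> a constant does.
  This allows the integrals left at the end of the iteration to be separated.\<close>

lemma in_Lp_integrable_mult:
  assumes g: "in_Lp p a b g" and p: "p = \<infinity> \<or> (\<exists>r\<ge>1. p = ereal r)" and h: "continuous_on {a..b} h"
  shows "integrable (lebesgue_on {a..b}) (\<lambda>x. g x * h x)"
proof -
  obtain M where M: "0 \<le> M" "\<And>x. x \<in> {a..b} \<Longrightarrow> \<bar>h x\<bar> \<le> M"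
    by (rule continuous_on_Icc_bounded[OF h]) blast
  have meas: "(\<lambda>x. g x * h x) \<in> borel_measurable (lebesgue_on {a..b})"
    using g continuous_imp_measurable_on_sets_lebesgue[OF h]
    by (intro borel_measurable_times) (auto simp: in_Lp_def)
  have const: "integrable (lebesgue_on {a..b}) (\<lambda>x. c)" for c :: real
    by (intro continuous_imp_integrable_real continuous_intros)
  from p show ?thesis
  proof (elim disjE exE conjE)
    assume "p = \<infinity>"
    then obtain C where "AE x in lebesgue_on {a..b}. \<bar>g x\<bar> \<le> C"
      using g by (auto simp: in_Lp_def)
    then have "AE x in lebesgue_on {a..b}. norm (g x * h x) \<le> norm (C * M)"
    proof (rule AE_mp[OF _ AE_I2], intro impI)
      fix x assume "x \<in> space (lebesgue_on {a..b})" "\<bar>g x\<bar> \<le> C"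
      then have "\<bar>g x\<bar> * \<bar>h x\<bar> \<le> C * M" using M by (intro mult_mono) auto
      then show "norm (g x * h x) \<le> norm (C * M)" by (metis abs_mult abs_ge_self order_trans real_norm_def)
    qed
    then show ?thesis by (rule Bochner_Integration.integrable_bound[OF const meas])
  next
    fix r assume r: "1 \<le> r" "p = ereal r"
    have "integrable (lebesgue_on {a..b}) (\<lambda>x. (1 + \<bar>g x\<bar> powr r) * M)"
      using g r const by (auto simp: in_Lp_def)
    moreover have "AE x in lebesgue_on {a..b}. norm (g x * h x) \<le> norm ((1 + \<bar>g x\<bar> powr r) * M)"
    proof (rule AE_I2)
      fix x assume x: "x \<in> space (lebesgue_on {a..b})"
      have "\<bar>g x\<bar> \<le> 1 + \<bar>g x\<bar> powr r"
      proof (cases "\<bar>g x\<bar> \<le> 1")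
        case False
        then have "\<bar>g x\<bar> powr 1 \<le> \<bar>g x\<bar> powr r" using r by (intro powr_mono) auto
        then show ?thesis by simp
      qed (simp add: add_increasing2)
      then have "\<bar>g x\<bar> * \<bar>h x\<bar> \<le> (1 + \<bar>g x\<bar> powr r) * M"
        using M x by (intro mult_mono) auto
      then show "norm (g x * h x) \<le> norm ((1 + \<bar>g x\<bar> powr r) * M)"
        by (metis abs_mult abs_ge_self order_trans real_norm_def)
    qed
    ultimately show ?thesis by (rule Bochner_Integration.integrable_bound[OF _ meas])
  qed
qed

lemma quadrature_identity:
  assumes "n \<ge> 1" "a < b" and p: "p = \<infinity> \<or> (\<exists>r\<ge>1. p = ereal r)"
    and adm: "admissible n p a b D" and phi: "monic_deg n \<phi>"
  shows "integral\<^sup>L (lebesgue_on {a..b}) (D 0) =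
       (-1) ^ n / fact n *
         (\<Sum>k<n. (-1) ^ (n - k - 1) *
            (poly ((pderiv ^^ (n - k - 1)) \<phi>) a * D k a
             - poly ((pderiv ^^ (n - k - 1)) \<phi>) b * D k b))
       + err_term n a b \<phi> D"
proof -
  define S where "S = (\<Sum>i<n. (-1) ^ i * (poly ((pderiv ^^ i) \<phi>) b * D (n - Suc i) b
                              - poly ((pderiv ^^ i) \<phi>) a * D (n - Suc i) a))"
  define I where "I = integral\<^sup>L (lebesgue_on {a..b}) (\<lambda>x. D n x * poly \<phi> x)"
  define J where "J = integral\<^sup>L (lebesgue_on {a..b}) (D 0)"
  have pd: "(pderiv ^^ n) \<phi> = [:fact n:]"
    using phi pderiv_funpow_degree[of \<phi> n] by (metis monic_deg_def mult_1_right)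
  have "(D 0 has_integral J) {a..b}"
    unfolding J_def using continuous_on_admissible[OF adm, of 0] assms(1)
    by (intro has_integral_integral_lebesgue_on continuous_imp_integrable_real) auto
  moreover have "((\<lambda>x. D n x * poly \<phi> x) has_integral I) {a..b}"
    unfolding I_def using adm
    by (intro has_integral_integral_lebesgue_on in_Lp_integrable_mult[OF _ p])
      (auto simp: admissible_def intro!: continuous_intros)
  ultimately have "((\<lambda>x. D n x * poly \<phi> x - (-1) ^ n * (D 0 x * fact n)) has_integral
      I - (-1) ^ n * (J * fact n)) {a..b}"
    by (intro has_integral_diff has_integral_mult_right has_integral_mult_left)
  moreover have "((\<lambda>x. D n x * poly \<phi> x - (-1) ^ n * (D 0 x * fact n)) has_integral S) {a..b}"
    using admissible_iterated_by_parts[OF adm assms(2) order_refl, of \<phi>] pd by (simp add: S_def)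
  ultimately have "I - (-1) ^ n * (J * fact n) = S"
    by (rule has_integral_unique)
  then have "(-1) ^ n / fact n * (I - S) = ((-1) ^ n * (-1) ^ n) * J"
    by (simp add: field_simps)
  then have J: "J = (-1) ^ n / fact n * (- S) + (-1) ^ n / fact n * I"
    by (simp add: power_add[symmetric] algebra_simps diff_divide_distrib)
  have "- S = (\<Sum>i<n. (-1) ^ i * (poly ((pderiv ^^ i) \<phi>) a * D (n - Suc i) a
                              - poly ((pderiv ^^ i) \<phi>) b * D (n - Suc i) b))"
    by (simp add: S_def sum_negf[symmetric] algebra_simps)
  also have "\<dots> = (\<Sum>k<n. (-1) ^ (n - k - 1) * (poly ((pderiv ^^ (n - k - 1)) \<phi>) a * D k a
             - poly ((pderiv ^^ (n - k - 1)) \<phi>) b * D k b))"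
    \<comment> \<open>The reversal \<open>k = n - 1 - i\<close>: the iteration runs from the highest
      derivative of \<open>f\<close> down, the formula from the lowest up.\<close>
    by (subst sum.nat_diff_reindex[symmetric]) (intro sum.cong; simp)
  finally show ?thesis
    using J by (simp add: J_def I_def err_term_def)
qed

section \<open>Hoelder's inequality and rescaling\<close>

lemma conjugate_expsE:
  assumes "conjugate_exps p q"
  obtains "p = \<infinity>" "q = 1" | "p = 1" "q = \<infinity>"
    | r s where "p = ereal r" "q = ereal s" "r > 1" "s > 1" "1 / r + 1 / s = 1"
  using assms unfolding conjugate_exps_def by blast

lemma continuous_on_abs_powr:
  fixes g :: "real \<Rightarrow> real"
  assumes "continuous_on S g" "0 < s"
  shows "continuous_on S (\<lambda>x. \<bar>g x\<bar> powr s)"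
  using assms by (intro continuous_on_powr' continuous_intros) auto

lemma integral_lebesgue_on_continuous:
  fixes g :: "real \<Rightarrow> real"
  assumes "continuous_on {a..b} g"
  shows "integral\<^sup>L (lebesgue_on {a..b}) g = integral {a..b} g"
  by (intro lebesgue_integral_eq_integral continuous_imp_integrable_real assms) auto

lemma Lp_norm_continuous:
  assumes "continuous_on {a..b} g" "0 < s"
  shows "Lp_norm (ereal s) a b g = integral {a..b} (\<lambda>x. \<bar>g x\<bar> powr s) powr (1 / s)"
  using integral_lebesgue_on_continuous[OF continuous_on_abs_powr[OF assms]]
  by (simp add: Lp_norm_def)

text \<open>The excess \<open>max 0 (g x - C)\<close> is continuous and nonnegative, and an almost
  everywhere bound makes its integral 0, so it vanishes at every point.\<close>

lemma AE_le_continuous_iff: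
  fixes g :: "real \<Rightarrow> real"
  assumes "a < b" and g: "continuous_on {a..b} g"
  shows "(AE x in lebesgue_on {a..b}. g x \<le> C) \<longleftrightarrow> (\<forall>x\<in>{a..b}. g x \<le> C)"
proof
  assume ae: "AE x in lebesgue_on {a..b}. g x \<le> C"
  have cont: "continuous_on {a..b} (\<lambda>x. max 0 (g x - C))"
    using g by (intro continuous_intros)
  have "integral {a..b} (\<lambda>x. max 0 (g x - C)) = integral\<^sup>L (lebesgue_on {a..b}) (\<lambda>x. max 0 (g x - C))"
    using integral_lebesgue_on_continuous[OF cont] by simp
  also have "\<dots> = 0"
    using ae by (intro integral_eq_zero_AE) (auto elim!: eventually_mono)
  finally have "\<forall>x\<in>{a..b}. max 0 (g x - C) = 0"
    using integral_eq_0_iff[OF cont \<open>a < b\<close>] by simp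
  then show "\<forall>x\<in>{a..b}. g x \<le> C" by (auto simp: max_def split: if_splits)
qed auto

text \<open>Essential bounds of a continuous function are pointwise bounds, so the infimum in
  \<open>Lp_norm\<close> is a maximum. This justifies reading the norm for
  \<open>q = \<infinity>\<close> as a maximum.\<close>

lemma Lp_norm_infinity_attained:
  assumes "a < b" and g: "continuous_on {a..b} g"
  obtains x where "x \<in> {a..b}" "Lp_norm \<infinity> a b g = \<bar>g x\<bar>" "\<And>y. y \<in> {a..b} \<Longrightarrow> \<bar>g y\<bar> \<le> \<bar>g x\<bar>"
proof -
  have cont: "continuous_on {a..b} (\<lambda>x. \<bar>g x\<bar>)" using g by (intro continuous_intros)
  obtain x where x: "x \<in> {a..b}" "\<And>y. y \<in> {a..b} \<Longrightarrow> \<bar>g y\<bar> \<le> \<bar>g x\<bar>"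
    using continuous_attains_sup[OF compact_Icc _ cont] \<open>a < b\<close> by auto
  have "Lp_norm \<infinity> a b g = Inf {C. \<forall>x\<in>{a..b}. \<bar>g x\<bar> \<le> C}"
    by (simp add: Lp_norm_def AE_le_continuous_iff[OF \<open>a < b\<close> cont])
  also have "{C. \<forall>x\<in>{a..b}. \<bar>g x\<bar> \<le> C} = {\<bar>g x\<bar>..}"
  proof (intro set_eqI iffI)
    fix C assume "C \<in> {\<bar>g x\<bar>..}"
    then have "\<bar>g y\<bar> \<le> C" if "y \<in> {a..b}" for y using x(2)[OF that] by simp
    then show "C \<in> {C. \<forall>y\<in>{a..b}. \<bar>g y\<bar> \<le> C}" by blast
  qed (use x(1) in simp)
  finally show thesis using x that by simp
qed

lemma Lp_norm_nonneg:
  assumes "in_Lp p a b g" "a < b"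
  shows "0 \<le> Lp_norm p a b g"
proof (cases "p = \<infinity>")
  case True
  have nonneg: "0 \<le> C" if "AE x in lebesgue_on {a..b}. \<bar>g x\<bar> \<le> C" for C
  proof (rule ccontr)
    assume "\<not> 0 \<le> C"
    \<comment> \<open>A false inequality between constants holding almost everywhere is carried to a
      genuine point by the criterion for continuous functions.\<close>
    have "AE x in lebesgue_on {a..b}. (1::real) \<le> 0"
      using that by (rule eventually_mono) (use \<open>\<not> 0 \<le> C\<close> in linarith)
    then have "\<forall>x\<in>{a..b}. (1::real) \<le> 0"
      by (simp only: AE_le_continuous_iff[OF assms(2) continuous_on_const])
    moreover have "a \<in> {a..b}" using assms(2) by simp
    ultimately have "(1::real) \<le> 0" by blast
    then show False by simp
  qed
  have "{C. AE x in lebesgue_on {a..b}. \<bar>g x\<bar> \<le> C} \<noteq> {}"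
    using True assms(1) by (simp add: in_Lp_def)
  then have "0 \<le> Inf {C. AE x in lebesgue_on {a..b}. \<bar>g x\<bar> \<le> C}"
  proof (rule cInf_greatest)
    fix C assume "C \<in> {C. AE x in lebesgue_on {a..b}. \<bar>g x\<bar> \<le> C}"
    then show "0 \<le> C" by (intro nonneg) (rule CollectD)
  qed
  then show ?thesis
    by (simp only: Lp_norm_def True refl if_True)
next
  case False
  then show ?thesis
    by (simp only: Lp_norm_def False if_False powr_ge_zero)
qed

lemma holder_finite:
  fixes g h :: "'a \<Rightarrow> real" and r s :: real
  assumes rs: "r > 1" "s > 1" "1 / r + 1 / s = 1"
    and meas: "g \<in> borel_measurable M" "h \<in> borel_measurable M"
    and int: "integrable M (\<lambda>x. \<bar>g x\<bar> powr r)" "integrable M (\<lambda>x. \<bar>h x\<bar> powr s)"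
  shows "(LINT x|M. \<bar>g x * h x\<bar>) \<le> (LINT x|M. \<bar>g x\<bar> powr r) powr (1 / r) * (LINT x|M. \<bar>h x\<bar> powr s) powr (1 / s)"
proof -
  define A B where "A = (LINT x|M. \<bar>g x\<bar> powr r)" and "B = (LINT x|M. \<bar>h x\<bar> powr s)"
  have "0 \<le> A" "0 \<le> B" by (auto simp: A_def B_def intro!: integral_nonneg_AE)
  show ?thesis
  proof (cases "A = 0 \<or> B = 0")
    case True
    then have "AE x in M. \<bar>g x * h x\<bar> = 0"
    proof
      assume "A = 0"
      then have "AE x in M. \<bar>g x\<bar> powr r = 0"
        using integral_nonneg_eq_0_iff_AE[OF int(1)] by (simp add: A_def)
      then show ?thesis by (auto elim!: eventually_mono)
    next
      assume "B = 0"
      then have "AE x in M. \<bar>h x\<bar> powr s = 0"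
        using integral_nonneg_eq_0_iff_AE[OF int(2)] by (simp add: B_def)
      then show ?thesis by (auto elim!: eventually_mono)
    qed
    then have "(LINT x|M. \<bar>g x * h x\<bar>) = 0" by (rule integral_eq_zero_AE)
    then show ?thesis by simp
  next
    case False
    with \<open>0 \<le> A\<close> \<open>0 \<le> B\<close> have pos: "0 < A" "0 < B" by auto
    \<comment> \<open>Young's inequality is applied to \<open>g\<close> and \<open>h\<close> divided
      by their norms, so that the right-hand side integrates to \<open>1 / r + 1 / s\<close>. The
      division is why vanishing norms were split off.\<close>
    define \<alpha> \<beta> where "\<alpha> = A powr (1 / r)" and "\<beta> = B powr (1 / s)"
    have \<alpha>\<beta>: "0 < \<alpha>" "0 < \<beta>" "\<alpha> powr r = A" "\<beta> powr s = B"
      using pos rs by (auto simp: \<alpha>_def \<beta>_def powr_powr)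
    have young: "\<bar>g x * h x\<bar> \<le> \<alpha> * \<beta> * (\<bar>g x\<bar> powr r / (A * r) + \<bar>h x\<bar> powr s / (B * s))" for x
    proof -
      have "\<bar>g x\<bar> / \<alpha> * (\<bar>h x\<bar> / \<beta>) \<le> (\<bar>g x\<bar> / \<alpha>) powr r / r + (\<bar>h x\<bar> / \<beta>) powr s / s"
        using \<alpha>\<beta> by (intro Youngs_inequality rs) auto
      also have "\<dots> = \<bar>g x\<bar> powr r / (A * r) + \<bar>h x\<bar> powr s / (B * s)"
        using \<alpha>\<beta> by (simp add: powr_divide)
      finally have "\<alpha> * \<beta> * (\<bar>g x\<bar> / \<alpha> * (\<bar>h x\<bar> / \<beta>))
          \<le> \<alpha> * \<beta> * (\<bar>g x\<bar> powr r / (A * r) + \<bar>h x\<bar> powr s / (B * s))"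
        using \<alpha>\<beta>(1,2) by (intro mult_left_mono) auto
      then show ?thesis
        using \<alpha>\<beta>(1,2) by (simp add: abs_mult)
    qed
    have int': "integrable M (\<lambda>x. \<alpha> * \<beta> * (\<bar>g x\<bar> powr r / (A * r) + \<bar>h x\<bar> powr s / (B * s)))"
      using int by simp
    have "(LINT x|M. \<bar>g x * h x\<bar>) \<le> (LINT x|M. \<alpha> * \<beta> * (\<bar>g x\<bar> powr r / (A * r) + \<bar>h x\<bar> powr s / (B * s)))"
    proof (rule integral_mono[OF _ int' young])
      show "integrable M (\<lambda>x. \<bar>g x * h x\<bar>)"
        using meas young by (intro Bochner_Integration.integrable_bound[OF int'] AE_I2) (auto intro: order_trans[OF _ abs_ge_self])
    qed
    also have "\<dots> = \<alpha> * \<beta> * (A / (A * r) + B / (B * s))"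
      using int by (simp add: A_def B_def)
    also have "\<dots> = \<alpha> * \<beta> * (1 / r + 1 / s)" using pos by simp
    also have "\<dots> = \<alpha> * \<beta>" using rs by simp
    finally show ?thesis by (simp add: \<alpha>_def \<beta>_def A_def B_def)
  qed
qed

lemma Lp_norm_holder:
  assumes "a < b" and pq: "conjugate_exps p q" and g: "in_Lp p a b g" and h: "continuous_on {a..b} h"
  shows "\<bar>integral\<^sup>L (lebesgue_on {a..b}) (\<lambda>x. g x * h x)\<bar> \<le> Lp_norm p a b g * Lp_norm q a b h"
proof -
  let ?M = "lebesgue_on {a..b}"
  have meas: "g \<in> borel_measurable ?M" "h \<in> borel_measurable ?M"
    using g continuous_imp_measurable_on_sets_lebesgue[OF h] by (auto simp: in_Lp_def)
  have le: "\<bar>integral\<^sup>L ?M (\<lambda>x. g x * h x)\<bar> \<le> integral\<^sup>L ?M (\<lambda>x. \<bar>g x * h x\<bar>)"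
    by (rule integral_abs_bound)
  have inth: "integrable ?M (\<lambda>x. \<bar>h x\<bar> powr s)" if "0 < s" for s
    using continuous_on_abs_powr[OF h that] by (rule continuous_imp_integrable_real)
  from pq show ?thesis
  proof (cases rule: conjugate_expsE)
    case 1
    define H where "H = integral\<^sup>L ?M (\<lambda>x. \<bar>h x\<bar>)"
    have H: "Lp_norm q a b h = H" "0 \<le> H"
      by (simp_all add: 1 Lp_norm_def H_def)
    \<comment> \<open>For \<open>p = \<infinity>\<close> the norm is an infimum of essential bounds,
      not by definition such a bound itself. The estimate is shown for each bound and then, after
      division by \<open>H\<close>, passed to the infimum.\<close>
    have C: "\<bar>integral\<^sup>L ?M (\<lambda>x. g x * h x)\<bar> \<le> C * H" if "AE x in ?M. \<bar>g x\<bar> \<le> C" for C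
    proof -
      have int: "integrable ?M (\<lambda>x. C * \<bar>h x\<bar>)" using inth[of 1] by simp
      have ae: "AE x in ?M. \<bar>g x * h x\<bar> \<le> C * \<bar>h x\<bar>"
        using that by (auto elim!: eventually_mono simp: abs_mult intro: mult_right_mono)
      have "integral\<^sup>L ?M (\<lambda>x. \<bar>g x * h x\<bar>) \<le> integral\<^sup>L ?M (\<lambda>x. C * \<bar>h x\<bar>)"
      proof (rule integral_mono_AE[OF _ int ae])
        show "integrable ?M (\<lambda>x. \<bar>g x * h x\<bar>)"
          using meas by (intro Bochner_Integration.integrable_bound[OF int] eventually_mono[OF ae])
            (auto intro: order_trans[OF _ abs_ge_self])
      qed
      also have "\<dots> = C * H" by (simp add: H_def)
      finally show ?thesis using le by linarith
    qed
    show ?thesis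
    proof (cases "H = 0")
      case True
      obtain C where "AE x in ?M. \<bar>g x\<bar> \<le> C" using g 1 by (auto simp: in_Lp_def)
      from C[OF this] show ?thesis by (simp add: H True)
    next
      case False
      with H have "0 < H" by simp
      have "\<bar>integral\<^sup>L ?M (\<lambda>x. g x * h x)\<bar> / H \<le> Lp_norm p a b g"
      proof -
        have "\<bar>integral\<^sup>L ?M (\<lambda>x. g x * h x)\<bar> / H \<le> Inf {C. AE x in ?M. \<bar>g x\<bar> \<le> C}"
        proof (rule cInf_greatest)
          show "{C. AE x in ?M. \<bar>g x\<bar> \<le> C} \<noteq> {}" using g 1 by (auto simp: in_Lp_def)
        qed (use C \<open>0 < H\<close> in \<open>auto simp: pos_divide_le_eq\<close>)
        then show ?thesis by (simp add: Lp_norm_def 1)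
      qed
      then show ?thesis using \<open>0 < H\<close> by (simp add: H pos_divide_le_eq)
    qed
  next
    case 2
    obtain x where x: "Lp_norm \<infinity> a b h = \<bar>h x\<bar>" "\<And>y. y \<in> {a..b} \<Longrightarrow> \<bar>h y\<bar> \<le> \<bar>h x\<bar>"
      by (rule Lp_norm_infinity_attained[OF \<open>a < b\<close> h]) blast
    have "integrable ?M (\<lambda>x. \<bar>g x\<bar> powr 1)" using g 2 by (simp add: in_Lp_def)
    then have int: "integrable ?M (\<lambda>y. \<bar>g y\<bar> * \<bar>h x\<bar>)" by simp
    have bd: "\<bar>g y * h y\<bar> \<le> \<bar>g y\<bar> * \<bar>h x\<bar>" if "y \<in> space ?M" for y
      using x(2)[of y] that by (simp add: abs_mult mult_left_mono)
    have "integral\<^sup>L ?M (\<lambda>x. \<bar>g x * h x\<bar>) \<le> integral\<^sup>L ?M (\<lambda>y. \<bar>g y\<bar> * \<bar>h x\<bar>)"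
    proof (rule integral_mono[OF _ int bd])
      show "integrable ?M (\<lambda>x. \<bar>g x * h x\<bar>)"
        using meas bd by (intro Bochner_Integration.integrable_bound[OF int] AE_I2)
            (auto intro: order_trans[OF _ abs_ge_self])
    qed
    also have "\<dots> = Lp_norm p a b g * Lp_norm q a b h"
      unfolding 2 x(1) by (simp add: Lp_norm_def)
    finally show ?thesis using le by linarith
  next
    case (3 r s)
    have "integral\<^sup>L ?M (\<lambda>x. \<bar>g x * h x\<bar>) \<le> Lp_norm p a b g * Lp_norm q a b h"
      using holder_finite[OF 3(3-5) meas _ inth] g 3 by (simp add: in_Lp_def Lp_norm_def)
    with le show ?thesis by linarith
  qed
qed

section \<open>Affine rescaling to the interval \<open>[-1,1]\<close>\<close>

lemma half_length_power_inverse: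
  fixes a b :: real
  assumes "a < b"
  shows "((b - a) / 2) ^ n * (2 / (b - a)) ^ n = 1"
proof -
  have "(b - a) / 2 * (2 / (b - a)) = 1" using assms by (simp add: divide_simps)
  then show ?thesis by (metis power_mult_distrib power_one)
qed

lemma poly_tilde_poly:
  assumes "a < b"
  shows "poly \<phi> x = ((b - a) / 2) ^ n * poly (tilde_poly n a b \<phi>) ((2 * x - a - b) / (b - a))"
proof -
  have "(a + b) / 2 + (2 * x - a - b) / (b - a) * ((b - a) / 2) = x"
    using assms by (simp add: field_simps)
  moreover have "((b - a) / 2) ^ n * (2 / (b - a)) ^ n = 1"
    by (rule half_length_power_inverse) fact
  ultimately show ?thesis
    by (simp add: tilde_poly_def poly_pcompose algebra_simps)
qed

lemma monic_deg_tilde_poly: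
  assumes "a < b" "monic_deg n \<phi>"
  shows "monic_deg n (tilde_poly n a b \<phi>)"
proof -
  have "lead_coeff (pcompose \<phi> [:(a + b) / 2, (b - a) / 2:]) = ((b - a) / 2) ^ n"
    using assms by (subst lead_coeff_comp) (auto simp: monic_deg_def)
  moreover have "((b - a) / 2) ^ n * (2 / (b - a)) ^ n = 1"
    by (rule half_length_power_inverse) fact
  moreover have "lead_coeff (tilde_poly n a b \<phi>)
      = (2 / (b - a)) ^ n * lead_coeff (pcompose \<phi> [:(a + b) / 2, (b - a) / 2:])"
    by (simp only: tilde_poly_def lead_coeff_smult)
  moreover have "degree (tilde_poly n a b \<phi>) = n"
    using assms by (simp add: tilde_poly_def monic_deg_def degree_pcompose)
  ultimately show ?thesis
    by (simp only: monic_deg_def mult.commute)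
qed

text \<open>With \<open>c\<close> half the length, the substitution contributes \<open>c ^ n\<close>
  from the polynomial and \<open>c powr inv_exp q\<close> from the change of variable; the powers of
  2 hidden in \<open>c\<close> are those of \<open>K_const\<close>. Being an equality, it serves the
  upper estimate and the sharpness alike.\<close>

lemma Lp_norm_eq_K_const:
  assumes "a < b" and q: "q = \<infinity> \<or> (\<exists>s>0. q = ereal s)"
  shows "Lp_norm q a b (poly \<phi>) / fact n
    = K_const n q (tilde_poly n a b \<phi>) * (b - a) powr (real n + inv_exp q)"
proof -
  define \<psi> where "\<psi> = tilde_poly n a b \<phi>"
  define c where "c = (b - a) / 2"
  have "0 < c" using \<open>a < b\<close> by (simp add: c_def)
  have \<phi>: "poly \<phi> x = c ^ n * poly \<psi> ((2 * x - a - b) / (b - a))" for x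
    unfolding c_def \<psi>_def by (rule poly_tilde_poly[OF \<open>a < b\<close>])
  have "Lp_norm q a b (poly \<phi>) = c powr (real n + inv_exp q) * Lp_norm q (-1) 1 (poly \<psi>)"
    using q
  proof (elim disjE exE conjE)
    assume q: "q = \<infinity>"
    obtain x where x: "x \<in> {a..b}" "Lp_norm \<infinity> a b (poly \<phi>) = \<bar>poly \<phi> x\<bar>"
      "\<And>y. y \<in> {a..b} \<Longrightarrow> \<bar>poly \<phi> y\<bar> \<le> \<bar>poly \<phi> x\<bar>"
      by (rule Lp_norm_infinity_attained[OF \<open>a < b\<close>, of "poly \<phi>"]) (auto intro!: continuous_intros)
    obtain z where z: "z \<in> {-1..1}" "Lp_norm \<infinity> (-1) 1 (poly \<psi>) = \<bar>poly \<psi> z\<bar>"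
      "\<And>y. y \<in> {-1..1} \<Longrightarrow> \<bar>poly \<psi> y\<bar> \<le> \<bar>poly \<psi> z\<bar>"
      by (rule Lp_norm_infinity_attained[of "-1" 1 "poly \<psi>"]) (auto intro!: continuous_intros)
    have "\<bar>poly \<phi> x\<bar> \<le> c ^ n * \<bar>poly \<psi> z\<bar>"
    proof -
      have "(2 * x - a - b) / (b - a) \<in> {-1..1}"
        using x(1) \<open>a < b\<close> by (auto simp: field_simps)
      from z(3)[OF this] show ?thesis
        using \<open>0 < c\<close> unfolding \<phi> by (simp add: abs_mult)
    qed
    moreover have "c ^ n * \<bar>poly \<psi> z\<bar> \<le> \<bar>poly \<phi> x\<bar>"
    proof -
      define y where "y = c * z + (a + b) / 2"
      have "2 * y - a - b = z * (b - a)"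
        by (simp add: y_def c_def field_simps)
      then have z_eq: "(2 * y - a - b) / (b - a) = z"
        using \<open>a < b\<close> by simp
      have "c * (-1) \<le> c * z" "c * z \<le> c * 1"
        by (rule mult_left_mono, use z(1) \<open>0 < c\<close> in auto)+
      moreover have "a = (a + b) / 2 - c" "b = (a + b) / 2 + c"
        by (simp_all add: c_def field_simps)
      ultimately have "y \<in> {a..b}" unfolding y_def by simp
      from x(3)[OF this] show ?thesis
        using \<open>0 < c\<close> unfolding \<phi>[of y] z_eq by (simp add: abs_mult)
    qed
    ultimately show ?thesis
      using \<open>0 < c\<close> by (simp add: q x z inv_exp_def powr_realpow)
  next
    fix s :: real assume s: "0 < s" "q = ereal s"
    have cont: "continuous_on {u..v} (poly \<theta>)" for u v and \<theta> :: "real poly"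
      by (intro continuous_intros)
    define I where "I = integral {-1..1} (\<lambda>x. \<bar>poly \<psi> x\<bar> powr s)"
    have "((\<lambda>x. \<bar>poly \<psi> x\<bar> powr s) has_integral I) (cbox (-1) 1)"
      unfolding I_def by (simp add: integrable_integral integrable_continuous_real continuous_on_abs_powr[OF cont s(1)])
    \<comment> \<open>The map \<open>m * x + d\<close> sends \<open>{a..b}\<close> onto
      \<open>{-1..1}\<close>; its Jacobian turns up as \<open>1 / m = c\<close>.\<close>
    moreover define m d where "m = 1 / c" and "d = - (a + b) / (b - a)"
    have "0 < m" using \<open>0 < c\<close> by (simp add: m_def)
    ultimately have "((\<lambda>x. \<bar>poly \<psi> (m * x + d)\<bar> powr s) has_integral I /\<^sub>R m)
        (cbox ((-1 - d) /\<^sub>R m) ((1 - d) /\<^sub>R m))"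
      using has_integral_affinity'[of "\<lambda>x. \<bar>poly \<psi> x\<bar> powr s" I "-1" 1 m d] by simp
    moreover have m: "m = 2 / (b - a)" by (simp add: m_def c_def)
    then have "m * x + d = (2 * x - a - b) / (b - a)" for x
      by (simp add: d_def diff_divide_distrib add_divide_distrib)
    moreover have "-1 - d = m * a" "1 - d = m * b"
      using \<open>a < b\<close> by (simp_all add: m d_def divide_simps)
    then have "(-1 - d) /\<^sub>R m = a" "(1 - d) /\<^sub>R m = b" "I /\<^sub>R m = c * I"
      using \<open>0 < m\<close> by (simp_all add: m_def)
    ultimately have "((\<lambda>x. \<bar>poly \<psi> ((2 * x - a - b) / (b - a))\<bar> powr s) has_integral c * I) {a..b}"
      by (simp only: cbox_interval)
    note scaled = has_integral_mult_right[OF this, of "(c ^ n) powr s"]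
    have "((\<lambda>x. \<bar>poly \<phi> x\<bar> powr s) has_integral (c ^ n) powr s * (c * I)) {a..b}"
    proof -
      have "\<bar>poly \<phi> x\<bar> powr s = (c ^ n) powr s * \<bar>poly \<psi> ((2 * x - a - b) / (b - a))\<bar> powr s" for x
        using \<open>0 < c\<close> unfolding \<phi>[of x] by (simp add: abs_mult powr_mult)
      with scaled show ?thesis by (simp only:)
    qed
    then have "Lp_norm q a b (poly \<phi>) = ((c ^ n) powr s * (c * I)) powr (1 / s)"
      unfolding s(2) Lp_norm_continuous[OF cont s(1)] by (simp add: integral_unique)
    also have "\<dots> = c ^ n * c powr (1 / s) * I powr (1 / s)"
    proof -
      have "0 \<le> I" unfolding I_def by (intro integral_nonneg integrable_continuous_real continuous_on_abs_powr[OF cont s(1)]) auto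
      then show ?thesis using \<open>0 < c\<close> s(1) by (simp add: powr_mult powr_powr)
    qed
    also have "\<dots> = c powr (real n + inv_exp q) * Lp_norm q (-1) 1 (poly \<psi>)"
      using \<open>0 < c\<close> unfolding s(2) Lp_norm_continuous[OF cont s(1)] I_def
      by (simp add: inv_exp_def powr_add powr_realpow)
    finally show ?thesis .
  qed
  moreover have "c powr (real n + inv_exp q) = 2 powr (- real n - inv_exp q) * (b - a) powr (real n + inv_exp q)"
  proof -
    have "c powr (real n + inv_exp q) = (b - a) powr (real n + inv_exp q) / 2 powr (real n + inv_exp q)"
      using \<open>a < b\<close> unfolding c_def by (simp add: powr_divide)
    moreover have "2 powr (- real n - inv_exp q) = 1 / 2 powr (real n + inv_exp q)"
      by (simp add: powr_minus_divide[symmetric])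
    ultimately show ?thesis by simp
  qed
  ultimately show ?thesis by (simp add: K_const_def \<psi>_def)
qed

section \<open>Monic polynomials of minimal norm, finite exponent\<close>

definition roots_poly :: "nat \<Rightarrow> (nat \<Rightarrow> real) \<Rightarrow> real poly" where
  "roots_poly n t = (\<Prod>i<n. [:- t i, 1:])"

lemma poly_roots_poly: "poly (roots_poly n t) x = (\<Prod>i<n. x - t i)"
  by (simp add: roots_poly_def poly_prod)

lemma monic_deg_prod_linear:
  assumes "finite A"
  shows "monic_deg (card A) (\<Prod>i\<in>A. [:- t i, 1:])"
  unfolding monic_deg_def
proof
  show "degree (\<Prod>i\<in>A. [:- t i, 1:]) = card A"
    using assms by (simp add: degree_prod_eq_sum_degree)
  show "lead_coeff (\<Prod>i\<in>A. [:- t i, 1:]) = 1"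
    unfolding lead_coeff_prod by simp
qed

lemma monic_deg_coeff: "monic_deg n \<psi> \<Longrightarrow> coeff \<psi> n = 1"
  by (auto simp: monic_deg_def)

lemma monic_deg_roots_poly: "monic_deg n (roots_poly n t)"
  using monic_deg_prod_linear[of "{..<n}" t] by (simp add: roots_poly_def)

lemma monic_deg_nonzero: "monic_deg n \<psi> \<Longrightarrow> \<psi> \<noteq> 0"
  by (auto simp: monic_deg_def)

lemma monic_deg_midpoint:
  assumes "monic_deg n \<psi>" "monic_deg n \<rho>"
  shows "monic_deg n (smult (1/2) (\<psi> + \<rho>))"
proof -
  have c: "coeff (\<psi> + \<rho>) n = 2" using assms by (simp add: monic_deg_coeff)
  have "degree (\<psi> + \<rho>) \<le> n" using assms by (auto simp: monic_deg_def intro: degree_add_le)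
  moreover have "n \<le> degree (\<psi> + \<rho>)" using c by (intro le_degree) simp
  ultimately have "degree (\<psi> + \<rho>) = n" by (rule antisym)
  with c show ?thesis by (simp add: monic_deg_def)
qed

lemma monic_deg_dvd_eq:
  assumes "monic_deg n \<psi>" "monic_deg n \<rho>" "\<rho> dvd \<psi>"
  shows "\<psi> = \<rho>"
proof -
  from assms(3) obtain k where k: "\<psi> = \<rho> * k" by blast
  with monic_deg_nonzero[OF assms(1)] have "\<rho> \<noteq> 0" "k \<noteq> 0" by auto
  then have "degree k = 0"
    using assms k by (simp add: monic_deg_def degree_mult_eq)
  moreover have "lead_coeff k = 1"
    using assms k by (metis lead_coeff_mult monic_deg_def mult_1)
  ultimately have "k = 1" by (auto elim!: degree_eq_zeroE simp: one_pCons)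
  with k show ?thesis by simp
qed

text \<open>Projecting the complex roots to \<open>[-1,1]\<close> moves them closer to every point of \<open>[-1,1]\<close>.\<close>
lemma monic_deg_dominates_roots_poly:
  assumes "monic_deg n \<psi>"
  obtains t where "\<And>i. t i \<in> {-1..1}"
    "\<And>x. x \<in> {-1..1} \<Longrightarrow> \<bar>poly (roots_poly n t) x\<bar> \<le> \<bar>poly \<psi> x\<bar>"
proof -
  define p where "p = map_poly complex_of_real \<psi>"
  obtain root where root: "smult (lead_coeff p) (\<Prod>i<degree p. [:-root i, 1:]) = p"
    by (rule complex_poly_decompose')
  have "degree p = n"
    using assms by (simp add: p_def monic_deg_def degree_map_poly)
  moreover have "coeff p n = 1"
    using monic_deg_coeff[OF assms] by (simp add: p_def coeff_map_poly)
  ultimately have "degree p = n" "lead_coeff p = 1" by simp_all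
  with root have p: "p = (\<Prod>i<n. [:-root i, 1:])" by simp
  define t where "t = (\<lambda>i. max (-1) (min 1 (Re (root i))))"
  show thesis
  proof (rule that)
    show "t i \<in> {-1..1}" for i by (auto simp: t_def)
    fix x :: real assume x: "x \<in> {-1..1}"
    have "\<bar>poly (roots_poly n t) x\<bar> = (\<Prod>i<n. \<bar>x - t i\<bar>)"
      by (simp add: poly_roots_poly abs_prod)
    also have "\<dots> \<le> (\<Prod>i<n. norm (complex_of_real x - root i))"
    proof (intro prod_mono conjI)
      fix i
      have "\<bar>x - t i\<bar> \<le> \<bar>x - Re (root i)\<bar>"
        using x by (auto simp: t_def min_def max_def)
      also have "\<dots> \<le> norm (complex_of_real x - root i)"
        using abs_Re_le_cmod[of "complex_of_real x - root i"] by simp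
      finally show "\<bar>x - t i\<bar> \<le> norm (complex_of_real x - root i)" .
    qed simp
    also have "\<dots> = norm (poly p (complex_of_real x))"
      by (simp add: p poly_prod prod_norm)
    also have "\<dots> = \<bar>poly \<psi> x\<bar>"
    proof -
      have "poly (map_poly complex_of_real \<psi>) (complex_of_real x) = complex_of_real (poly \<psi> x)"
        by (induction \<psi>) (simp_all add: map_poly_pCons)
      then show ?thesis by (simp add: p_def)
    qed
    finally show "\<bar>poly (roots_poly n t) x\<bar> \<le> \<bar>poly \<psi> x\<bar>" .
  qed
qed

text \<open>Cancelling \<open>x - t\<close> in an inequality loses the point \<open>t\<close>. It is
  a limit point of a nondegenerate interval, so continuity returns it.\<close>

lemma nonneg_at_removed_point:
  fixes h :: "real \<Rightarrow> real"
  assumes "continuous_on UNIV h" "t \<in> {a..b}" "a < b" "\<And>x. \<lbrakk>x \<in> {a..b}; x \<noteq> t\<rbrakk> \<Longrightarrow> 0 \<le> h x"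
  shows "0 \<le> h t"
proof -
  have "t islimpt {a..b}" using assms by (simp add: islimpt_Icc)
  then have "t \<in> closure ({a..b} - {t})" by (simp add: islimpt_in_closure)
  then show ?thesis
    using assms by (intro continuous_ge_on_closure[of "{a..b} - {t}" h t 0]) (auto intro: continuous_on_subset)
qed

text \<open>The bound forces \<open>\<psi>\<close> to vanish at the last root; cancelling that
  linear factor leaves a bound of the same kind, at the root itself by continuity. Removing one root
  at a time handles repeated ones without counting multiplicities.\<close>

lemma roots_poly_dvd:
  assumes "\<And>i. i < n \<Longrightarrow> t i \<in> {a..b}" "a < b"
    and "\<And>x. x \<in> {a..b} \<Longrightarrow> \<bar>poly \<psi> x\<bar> \<le> C * \<bar>poly (roots_poly n t) x\<bar>"
  shows "roots_poly n t dvd \<psi>"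
  using assms
proof (induction n arbitrary: \<psi>)
  case 0
  then show ?case by (simp add: roots_poly_def)
next
  case (Suc n)
  have t: "t n \<in> {a..b}" using Suc.prems by simp
  have "poly \<psi> (t n) = 0"
    using Suc.prems(3)[OF t] by (simp add: poly_roots_poly)
  then obtain \<rho> where \<rho>: "\<psi> = [:- t n, 1:] * \<rho>"
    by (auto simp: poly_eq_0_iff_dvd)
  have le: "\<bar>poly \<rho> x\<bar> \<le> C * \<bar>poly (roots_poly n t) x\<bar>" if "x \<in> {a..b}" "x \<noteq> t n" for x
  proof -
    have "\<bar>x - t n\<bar> * \<bar>poly \<rho> x\<bar> \<le> \<bar>x - t n\<bar> * (C * \<bar>poly (roots_poly n t) x\<bar>)"
      using Suc.prems(3)[OF that(1)]
      by (simp add: \<rho> poly_roots_poly abs_mult[symmetric] algebra_simps)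
    then show ?thesis using that(2) by simp
  qed
  have "0 \<le> C * \<bar>poly (roots_poly n t) (t n)\<bar> - \<bar>poly \<rho> (t n)\<bar>"
    by (rule nonneg_at_removed_point[OF _ t Suc.prems(2)]) (use le in \<open>auto intro!: continuous_intros\<close>)
  with le have "\<bar>poly \<rho> x\<bar> \<le> C * \<bar>poly (roots_poly n t) x\<bar>" if "x \<in> {a..b}" for x
    using that by (cases "x = t n") auto
  then have "roots_poly n t dvd \<rho>"
    using Suc.prems by (intro Suc.IH) auto
  then have "roots_poly n t * [:- t n, 1:] dvd \<rho> * [:- t n, 1:]"
    by (rule mult_dvd_mono) simp
  moreover have "roots_poly (Suc n) t = roots_poly n t * [:- t n, 1:]"
    unfolding roots_poly_def by (rule prod.lessThan_Suc)
  ultimately show ?case by (simp only: \<rho> mult.commute)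
qed

text \<open>The norm raised to the power \<open>s\<close>: it has the same minimisers, and convexity
  applies to it pointwise under the integral.\<close>

definition power_integral :: "real \<Rightarrow> real poly \<Rightarrow> real" where
  "power_integral s \<psi> = integral {-1..1} (\<lambda>x. \<bar>poly \<psi> x\<bar> powr s)"

lemma continuous_on_abs_poly_powr:
  "0 < s \<Longrightarrow> continuous_on S (\<lambda>x::real. \<bar>poly \<psi> x\<bar> powr s)"
  by (intro continuous_on_abs_powr continuous_intros)

lemma power_integral_nonneg: "0 < s \<Longrightarrow> 0 \<le> power_integral s \<psi>"
  unfolding power_integral_def
  by (intro integral_nonneg integrable_continuous_real continuous_on_abs_poly_powr) auto

lemma power_integral_mono:
  assumes "0 < s" "\<And>x. x \<in> {-1..1} \<Longrightarrow> \<bar>poly \<psi> x\<bar> \<le> \<bar>poly \<rho> x\<bar>"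
  shows "power_integral s \<psi> \<le> power_integral s \<rho>"
  unfolding power_integral_def using assms
  by (intro integral_le integrable_continuous_real continuous_on_abs_poly_powr powr_mono2) auto

lemma power_integral_attains_min:
  assumes "0 < s"
  obtains \<psi> where "monic_deg n \<psi>" "\<And>\<rho>. monic_deg n \<rho> \<Longrightarrow> power_integral s \<psi> \<le> power_integral s \<rho>"
proof -
  \<comment> \<open>The cube lives in the space of all sequences, compact by Tychonoff's theorem;
    \<open>roots_poly n\<close> reads only the first \<open>n\<close> coordinates.\<close>
  define K where "K = (PiE UNIV (\<lambda>_. {-1..1}) :: (nat \<Rightarrow> real) set)"
  have "compactin (product_topology (\<lambda>_. euclidean) UNIV) K"
    unfolding K_def by (subst compactin_PiE) auto
  then have "compact K" by (simp add: euclidean_product_topology)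
  have "(\<lambda>_. 0) \<in> K" by (simp add: K_def PiE_iff)
  have coord: "continuous_on S (\<lambda>z. fst z i)" for S :: "((nat \<Rightarrow> real) \<times> real) set" and i
    by (rule continuous_on_product_then_coordinatewise) (intro continuous_intros)
  have "continuous_on K (\<lambda>t. integral (cbox (-1) 1) (\<lambda>x. \<bar>\<Prod>i<n. x - t i\<bar> powr s))"
    by (rule integral_continuous_on_param)
      (unfold case_prod_beta, intro continuous_on_powr' continuous_intros coord, use assms in auto)
  from continuous_attains_inf[OF \<open>compact K\<close> _ this] \<open>(\<lambda>_. 0) \<in> K\<close>
  obtain t where t: "t \<in> K" "\<And>u. u \<in> K \<Longrightarrow> power_integral s (roots_poly n t) \<le> power_integral s (roots_poly n u)"
    by (auto simp: power_integral_def poly_roots_poly)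
  show thesis
  proof (rule that[OF monic_deg_roots_poly])
    fix \<rho> assume "monic_deg n \<rho>"
    then obtain u where u: "\<And>i. u i \<in> {-1..1}"
      "\<And>x. x \<in> {-1..1} \<Longrightarrow> \<bar>poly (roots_poly n u) x\<bar> \<le> \<bar>poly \<rho> x\<bar>"
      by (rule monic_deg_dominates_roots_poly) blast
    have "power_integral s (roots_poly n t) \<le> power_integral s (roots_poly n u)"
      using u(1) by (intro t(2)) (auto simp: K_def)
    also have "\<dots> \<le> power_integral s \<rho>"
      by (rule power_integral_mono[OF assms u(2)])
    finally show "power_integral s (roots_poly n t) \<le> power_integral s \<rho>" .
  qed
qed

lemma powr_midpoint_le:
  fixes u v s :: real
  assumes "1 \<le> s" "0 \<le> u" "0 \<le> v"
  shows "((u + v) / 2) powr s \<le> (u powr s + v powr s) / 2"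
proof (cases "u = 0 \<or> v = 0")
  case True
  \<comment> \<open>Convexity is invoked on the open half-line only; with one number equal to 0 the
    claim comes down to \<open>2 \<le> 2 powr s\<close>.\<close>
  have "2 powr 1 \<le> 2 powr s" using assms by (intro powr_mono) auto
  then have "w powr s / 2 powr s \<le> w powr s / 2" for w :: real
    by (intro divide_left_mono) auto
  then have "(w / 2) powr s \<le> w powr s / 2" if "0 \<le> w" for w :: real
    using that by (simp add: powr_divide)
  from this[of u] this[of v] True assms show ?thesis by auto
next
  case False
  with assms have "u \<in> {0<..}" "v \<in> {0<..}" by auto
  from convex_onD[OF powr_convex[OF assms(1)], of "1/2" u v] this
  show ?thesis by (simp add: add_divide_distrib)
qed

text \<open>The midpoint of two minimisers is a minimiser, so equality in the convexity inequality bounds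
  each of them by a multiple of a real-rooted polynomial with all roots in \<open>[-1,1]\<close>,
  which must therefore divide both.\<close>
lemma power_integral_min_unique:
  assumes "1 \<le> s" and monic: "monic_deg n \<psi>" "monic_deg n \<psi>'"
    and min: "\<And>\<rho>. monic_deg n \<rho> \<Longrightarrow> power_integral s \<psi> \<le> power_integral s \<rho>"
      "\<And>\<rho>. monic_deg n \<rho> \<Longrightarrow> power_integral s \<psi>' \<le> power_integral s \<rho>"
  shows "\<psi> = \<psi>'"
proof -
  have "0 < s" using assms(1) by simp
  note cont = continuous_on_abs_poly_powr[OF \<open>0 < s\<close>]
  obtain t where t: "\<And>i. t i \<in> {-1..1}" and dom: "\<And>x. x \<in> {-1..1} \<Longrightarrow>
      \<bar>poly (roots_poly n t) x\<bar> \<le> \<bar>poly (smult (1/2) (\<psi> + \<psi>')) x\<bar>"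
    by (rule monic_deg_dominates_roots_poly[OF monic_deg_midpoint[OF monic]]) blast
  \<comment> \<open>The comparison uses the polynomial dominated by the midpoint, not the midpoint
    itself: its roots lie in \<open>[-1,1]\<close>, as the divisibility argument requires.\<close>
  define r where "r = roots_poly n t"
  define h where "h = (\<lambda>x. (\<bar>poly \<psi> x\<bar> powr s + \<bar>poly \<psi>' x\<bar> powr s) / 2 - \<bar>poly r x\<bar> powr s)"
  have h_nonneg: "0 \<le> h x" if "x \<in> {-1..1}" for x
  proof -
    have "\<bar>poly r x\<bar> \<le> (\<bar>poly \<psi> x\<bar> + \<bar>poly \<psi>' x\<bar>) / 2"
      using dom[OF that] abs_triangle_ineq[of "poly \<psi> x" "poly \<psi>' x"]
      by (simp add: r_def[symmetric] abs_mult)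
    then have "\<bar>poly r x\<bar> powr s \<le> ((\<bar>poly \<psi> x\<bar> + \<bar>poly \<psi>' x\<bar>) / 2) powr s"
      using \<open>0 < s\<close> by (intro powr_mono2) auto
    also have "\<dots> \<le> (\<bar>poly \<psi> x\<bar> powr s + \<bar>poly \<psi>' x\<bar> powr s) / 2"
      using assms(1) by (intro powr_midpoint_le) auto
    finally show ?thesis by (simp add: h_def)
  qed
  have conth: "continuous_on {-1..1} h"
    unfolding h_def by (intro continuous_intros cont) auto
  have "(h has_integral ((power_integral s \<psi> + power_integral s \<psi>') / 2 - power_integral s r)) {-1..1}"
    unfolding h_def power_integral_def
    by (intro has_integral_diff has_integral_divide has_integral_add integrable_integral
        integrable_continuous_real cont)
  then have "integral {-1..1} h = (power_integral s \<psi> + power_integral s \<psi>') / 2 - power_integral s r"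
    by (rule integral_unique)
  \<comment> \<open>\<open>r\<close> competes with both minimisers, so its integral is at least the
    mean of theirs.\<close>
  also have "\<dots> \<le> 0"
    using min[of r] monic_deg_roots_poly[of n t] by (simp add: r_def)
  finally have "integral {-1..1} h = 0"
    using integral_nonneg[OF integrable_continuous_real[OF conth]] h_nonneg by (intro antisym) auto
  then have h0: "h x = 0" if "x \<in> {-1..1}" for x
    using integral_eq_0_iff[OF conth] h_nonneg that by simp
  then have sum_eq: "\<bar>poly \<psi> x\<bar> powr s + \<bar>poly \<psi>' x\<bar> powr s = 2 * \<bar>poly r x\<bar> powr s" if "x \<in> {-1..1}" for x
    using that by (force simp: h_def field_simps)
  \<comment> \<open>Each summand on the left of \<open>sum_eq\<close> is at most the whole; the
    \<open>s\<close>-th root turns the factor 2 into \<open>2 powr (1 / s)\<close>.\<close>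
  have root: "u \<le> 2 powr (1 / s) * v" if "u powr s \<le> 2 * v powr s" "0 \<le> u" "0 \<le> v" for u v :: real
  proof -
    have "(u powr s) powr (1 / s) \<le> (2 * v powr s) powr (1 / s)"
      using that \<open>0 < s\<close> by (intro powr_mono2) auto
    then show ?thesis using that \<open>0 < s\<close> by (simp add: powr_mult powr_powr)
  qed
  have "r dvd \<psi>"
    unfolding r_def
  proof (rule roots_poly_dvd)
    fix x :: real assume "x \<in> {-1..1}"
    then have "\<bar>poly \<psi> x\<bar> powr s \<le> 2 * \<bar>poly r x\<bar> powr s"
      using sum_eq[of x] powr_ge_zero[of "\<bar>poly \<psi>' x\<bar>" s] by linarith
    from root[OF this] show "\<bar>poly \<psi> x\<bar> \<le> 2 powr (1 / s) * \<bar>poly (roots_poly n t) x\<bar>"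
      by (simp add: r_def)
  qed (use t in auto)
  moreover have "r dvd \<psi>'"
    unfolding r_def
  proof (rule roots_poly_dvd)
    fix x :: real assume "x \<in> {-1..1}"
    then have "\<bar>poly \<psi>' x\<bar> powr s \<le> 2 * \<bar>poly r x\<bar> powr s"
      using sum_eq[of x] powr_ge_zero[of "\<bar>poly \<psi> x\<bar>" s] by linarith
    from root[OF this] show "\<bar>poly \<psi>' x\<bar> \<le> 2 powr (1 / s) * \<bar>poly (roots_poly n t) x\<bar>"
      by (simp add: r_def)
  qed (use t in auto)
  ultimately have "\<psi> = r" "\<psi>' = r"
    using monic monic_deg_roots_poly[of n t] by (auto simp: r_def intro: monic_deg_dvd_eq)
  then show ?thesis by simp
qed

section \<open>Monic polynomials of minimal norm, infinite exponent\<close>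

text \<open>Top coefficients are compared in Lagrange's interpolation formula, where each basis
  product consists of \<open>n\<close> monic linear factors. The right-hand side is the divided
  difference of \<open>p\<close> at the nodes.\<close>

lemma lagrange_top_coeff:
  fixes p :: "real poly"
  assumes x: "inj_on x {..n}" and "degree p \<le> n"
  shows "coeff p n = (\<Sum>i\<le>n. poly p (x i) / (\<Prod>j\<in>{..n} - {i}. x i - x j))"
proof -
  define B where "B = (\<lambda>i. \<Prod>j\<in>{..n} - {i}. [:- x j, 1:])"
  define w where "w = (\<lambda>i. \<Prod>j\<in>{..n} - {i}. x i - x j)"
  define L where "L = (\<Sum>i\<le>n. smult (poly p (x i) / w i) (B i))"
  have card: "card ({..n} - {i}) = n" if "i \<le> n" for i using that by simp
  have B: "degree (B i) = n" "coeff (B i) n = 1" if "i \<le> n" for i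
    using monic_deg_prod_linear[of "{..n} - {i}" x] card[OF that] unfolding B_def monic_deg_def by auto
  have w: "w i \<noteq> 0" if "i \<le> n" for i
    using x that by (auto simp: w_def inj_on_def)
  have "p = L"
  proof (rule poly_eqI_degree[of "x ` {..n}"])
    have poly_B: "poly (B i) (x k) = (if i = k then w k else 0)" if "k \<le> n" for i k
      using that by (auto simp: B_def w_def poly_prod)
    have "poly L (x k) = poly p (x k)" if k: "k \<le> n" for k
    proof -
      have "poly (smult (poly p (x i) / w i) (B i)) (x k) = (if i = k then poly p (x k) else 0)" for i
        using w[OF k] by (simp add: poly_B[OF k])
      then have "poly L (x k) = (\<Sum>i\<le>n. if i = k then poly p (x k) else 0)"
        unfolding L_def poly_sum by simp
      with k show ?thesis by simp
    qed
    then show "poly p y = poly L y" if "y \<in> x ` {..n}" for y using that by auto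
    have "degree L \<le> n"
      unfolding L_def using B by (intro degree_sum_le) (auto intro: order_trans[OF degree_smult_le])
    then show "degree L < card (x ` {..n})" "degree p < card (x ` {..n})"
      using assms by (simp_all add: card_image)
  qed
  then have "coeff p n = coeff L n" by simp
  also have "\<dots> = (\<Sum>i\<le>n. poly p (x i) / w i)"
    unfolding L_def coeff_sum using B by (intro sum.cong) auto
  finally show ?thesis by (simp add: w_def)
qed

text \<open>The nodes decrease, so exactly the \<open>i\<close> factors with \<open>j < i\<close>
  are negative.\<close>

lemma alternating_node_weight_pos:
  fixes x :: "nat \<Rightarrow> real"
  assumes dec: "\<And>i j. \<lbrakk>i < j; j \<le> n\<rbrakk> \<Longrightarrow> x j < x i" and "i \<le> n"
  shows "0 < (-1) ^ i * (\<Prod>j\<in>{..n} - {i}. x i - x j)"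
proof -
  have "{..n} - {i} = {..<i} \<union> {i<..n}" using assms(2) by auto
  moreover have "(\<Prod>j\<in>{..<i} \<union> {i<..n}. x i - x j) = (\<Prod>j<i. x i - x j) * (\<Prod>j\<in>{i<..n}. x i - x j)"
    by (rule prod.union_disjoint) auto
  ultimately have "(-1) ^ i * (\<Prod>j\<in>{..n} - {i}. x i - x j)
      = (-1) ^ i * ((\<Prod>j<i. x i - x j) * (\<Prod>j\<in>{i<..n}. x i - x j))"
    by simp
  also have "\<dots> = (\<Prod>j<i. (-1) * (x i - x j)) * (\<Prod>j\<in>{i<..n}. x i - x j)"
    by (simp only: prod.distrib prod_constant card_lessThan mult.assoc)
  also have "\<dots> > 0"
  proof (rule mult_pos_pos)
    show "0 < (\<Prod>j<i. (-1) * (x i - x j))" using assms by (intro prod_pos) auto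
    show "0 < (\<Prod>j\<in>{i<..n}. x i - x j)" using assms by (intro prod_pos) auto
  qed
  finally show ?thesis .
qed

text \<open>\<open>T - \<psi>\<close> has no term of degree \<open>n\<close>, so the weighted sum of
  its values at the nodes is 0. The signs of \<open>T\<close> match those of the weights, which
  makes every summand nonnegative. Hence all vanish, and agreement at \<open>n + 1\<close> nodes
  suffices in degree \<open>n\<close>.\<close>

lemma equioscillation_unique:
  assumes dec: "\<And>i j. \<lbrakk>i < j; j \<le> n\<rbrakk> \<Longrightarrow> x j < x i"
    and monic: "monic_deg n T" "monic_deg n \<psi>"
    and T: "\<And>i. i \<le> n \<Longrightarrow> poly T (x i) = (-1) ^ i * M"
    and \<psi>: "\<And>i. i \<le> n \<Longrightarrow> \<bar>poly \<psi> (x i)\<bar> \<le> M"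
  shows "\<psi> = T"
proof -
  have inj: "inj_on x {..n}"
    using dec by (intro linorder_inj_onI) (auto simp: neq_iff)
  define w where "w = (\<lambda>i. \<Prod>j\<in>{..n} - {i}. x i - x j)"
  have w: "0 < (-1) ^ i * w i" if "i \<le> n" for i
    unfolding w_def by (rule alternating_node_weight_pos[OF dec that])
  have summand: "poly (T - \<psi>) (x i) / w i = (M - (-1) ^ i * poly \<psi> (x i)) / ((-1) ^ i * w i)"
    if "i \<le> n" for i
  proof -
    have "(-1) ^ i * poly (T - \<psi>) (x i) = ((-1) ^ i * (-1) ^ i) * M - (-1) ^ i * poly \<psi> (x i)"
      by (simp add: T[OF that] algebra_simps)
    also have "(-1) ^ i * (-1) ^ i = (1::real)" by (simp add: power_add[symmetric])
    finally have "M - (-1) ^ i * poly \<psi> (x i) = (-1) ^ i * poly (T - \<psi>) (x i)" by simp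
    then show ?thesis by simp
  qed
  have bound: "(-1) ^ i * poly \<psi> (x i) \<le> M" if "i \<le> n" for i
    using \<psi>[OF that] by (cases "even i") auto
  have "degree (T - \<psi>) \<le> n" using monic by (auto simp: monic_deg_def intro: degree_diff_le)
  then have "(\<Sum>i\<le>n. poly (T - \<psi>) (x i) / w i) = coeff (T - \<psi>) n"
    unfolding w_def by (rule lagrange_top_coeff[OF inj, symmetric])
  also have "\<dots> = 0" using monic by (simp add: monic_deg_coeff)
  finally have "(\<Sum>i\<le>n. poly (T - \<psi>) (x i) / w i) = 0" .
  moreover have "0 \<le> poly (T - \<psi>) (x i) / w i" if "i \<in> {..n}" for i
    using that w[of i] bound[of i] unfolding summand[of i, OF that[simplified]]
    by (intro divide_nonneg_pos) auto
  ultimately have "\<forall>i\<in>{..n}. poly (T - \<psi>) (x i) / w i = 0"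
    by (simp only: sum_nonneg_eq_0_iff[OF finite_atMost])
  then have eq: "poly (T - \<psi>) (x i) = 0" if "i \<le> n" for i
    using that w[OF that] by auto
  show ?thesis
  proof (rule poly_eqI_degree[of "x ` {..n}"])
    show "poly \<psi> y = poly T y" if "y \<in> x ` {..n}" for y
      using eq that by auto
    show "degree \<psi> < card (x ` {..n})" "degree T < card (x ` {..n})"
      using monic inj by (simp_all add: card_image monic_deg_def)
  qed
qed

fun chebyshev_poly :: "nat \<Rightarrow> real poly" where
  "chebyshev_poly 0 = 1"
| "chebyshev_poly (Suc 0) = [:0, 1:]"
| "chebyshev_poly (Suc (Suc n)) = [:0, 2:] * chebyshev_poly (Suc n) - chebyshev_poly n"

lemma poly_chebyshev_cos: "poly (chebyshev_poly n) (cos \<theta>) = cos (real n * \<theta>)"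
proof (induction n rule: chebyshev_poly.induct)
  case (3 n)
  have "cos (real (Suc (Suc n)) * \<theta>) + cos (real n * \<theta>) = 2 * cos \<theta> * cos (real (Suc n) * \<theta>)"
  proof -
    have "real (Suc (Suc n)) * \<theta> = real (Suc n) * \<theta> + \<theta>" "real n * \<theta> = real (Suc n) * \<theta> - \<theta>"
      by (simp_all add: algebra_simps)
    then show ?thesis by (simp only: cos_add cos_diff) simp
  qed
  with 3 show ?case by simp
qed simp_all

lemma degree_chebyshev_le: "degree (chebyshev_poly n) \<le> n"
proof (induction n rule: chebyshev_poly.induct)
  case (3 n)
  have "degree ([:0, 2:] * chebyshev_poly (Suc n)) \<le> Suc (Suc n)"
    using 3 by (intro order_trans[OF degree_mult_le]) auto
  with 3 show ?case by (auto intro!: degree_diff_le)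
qed simp_all

lemma coeff_chebyshev: "coeff (chebyshev_poly (Suc n)) (Suc n) = 2 ^ n"
proof (induction n)
  case (Suc n)
  have "coeff (chebyshev_poly n) (Suc (Suc n)) = 0"
    using degree_chebyshev_le[of n] by (intro coeff_eq_0) simp
  with Suc show ?case by simp
qed simp

lemma monic_chebyshev:
  assumes "n \<ge> 1"
  shows "monic_deg n (smult (1 / 2 ^ (n - 1)) (chebyshev_poly n))"
proof -
  have c: "coeff (chebyshev_poly n) n = 2 ^ (n - 1)"
    using coeff_chebyshev[of "n - 1"] assms by simp
  then have "n \<le> degree (chebyshev_poly n)" by (intro le_degree) simp
  with degree_chebyshev_le[of n] have "degree (chebyshev_poly n) = n" by simp
  with c show ?thesis by (simp add: monic_deg_def)
qed

text \<open>The last clause yields minimality and uniqueness together: a competitor with maximum at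
  most \<open>M\<close>, in particular a smaller one, must be \<open>T\<close>, and \<open>T\<close>
  attains \<open>M\<close>.\<close>

lemma chebyshev_minimax:
  assumes "n \<ge> 1"
  obtains T M where "monic_deg n T" "\<And>x. x \<in> {-1..1} \<Longrightarrow> \<bar>poly T x\<bar> \<le> M"
    "\<exists>x\<in>{-1..1}. \<bar>poly T x\<bar> = M"
    "\<And>\<psi>. \<lbrakk>monic_deg n \<psi>; \<And>x. x \<in> {-1..1} \<Longrightarrow> \<bar>poly \<psi> x\<bar> \<le> M\<rbrakk> \<Longrightarrow> \<psi> = T"
proof -
  \<comment> \<open>The Chebyshev polynomial has leading coefficient \<open>2 ^ (n - 1)\<close> and
    maximum modulus 1, so \<open>M\<close> is both the normalising factor and the norm of the monic
    multiple.\<close>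
  define M :: real where "M = 1 / 2 ^ (n - 1)"
  define T where "T = smult M (chebyshev_poly n)"
  have "0 < M" by (simp add: M_def)
  have T: "monic_deg n T" unfolding T_def M_def by (rule monic_chebyshev[OF assms])
  have Tcos: "poly T (cos \<theta>) = cos (real n * \<theta>) * M" for \<theta>
    by (simp add: T_def poly_chebyshev_cos)
  \<comment> \<open>The points where \<open>cos (real n * \<theta>)\<close> is 1 and -1 in turn;
    cosine decreases on \<open>[0,pi]\<close>, so they run down from 1 to -1.\<close>
  define x where "x = (\<lambda>i. cos (real i * pi / real n))"
  show thesis
  proof (rule that[OF T])
    show "\<bar>poly T y\<bar> \<le> M" if "y \<in> {-1..1}" for y
    proof -
      have "poly T y = cos (real n * arccos y) * M"
        using Tcos[of "arccos y"] that by simp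
      then show ?thesis
        using \<open>0 < M\<close> abs_cos_le_one[of "real n * arccos y"] by (simp add: abs_mult mult_left_le_one_le)
    qed
    show "\<exists>x\<in>{-1..1}. \<bar>poly T x\<bar> = M"
      using Tcos[of 0] \<open>0 < M\<close> by (intro bexI[of _ 1]) auto
    fix \<psi> assume \<psi>: "monic_deg n \<psi>" "\<And>x. x \<in> {-1..1} \<Longrightarrow> \<bar>poly \<psi> x\<bar> \<le> M"
    show "\<psi> = T"
    proof (rule equioscillation_unique[OF _ T \<psi>(1), of x M])
      show "x j < x i" if "i < j" "j \<le> n" for i j
      proof -
        have "real j * pi / real n \<le> pi"
          using that assms by (simp add: field_simps)
        moreover have "real i * pi / real n < real j * pi / real n"
          using that assms by (intro divide_strict_right_mono mult_strict_right_mono) auto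
        ultimately show ?thesis unfolding x_def by (intro cos_monotone_0_pi) auto
      qed
      show "poly T (x i) = (-1) ^ i * M" if "i \<le> n" for i
        using assms by (simp add: x_def Tcos cos_npi)
      show "\<bar>poly \<psi> (x i)\<bar> \<le> M" for i
        by (rule \<psi>(2)) (simp add: x_def)
    qed
  qed
qed

section \<open>Sharpness\<close>

lemma in_Lp_continuous:
  assumes h: "continuous_on {a..b} h" and p: "p = \<infinity> \<or> (\<exists>r\<ge>1. p = ereal r)"
  shows "in_Lp p a b h"
proof -
  have meas: "h \<in> borel_measurable (lebesgue_on {a..b})"
    using h by (rule continuous_imp_measurable_on_sets_lebesgue) simp
  from p show ?thesis
  proof (elim disjE exE conjE)
    assume p: "p = \<infinity>"
    obtain M where "\<And>x. x \<in> {a..b} \<Longrightarrow> \<bar>h x\<bar> \<le> M"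
      by (rule continuous_on_Icc_bounded[OF h]) blast
    then have "AE x in lebesgue_on {a..b}. \<bar>h x\<bar> \<le> M" by (intro AE_I2) simp
    with meas p show ?thesis unfolding in_Lp_def by auto
  next
    fix r assume "1 \<le> r" "p = ereal r"
    with meas show ?thesis
      unfolding in_Lp_def by (simp add: continuous_imp_integrable_real continuous_on_abs_powr[OF h])
  qed
qed

lemma continuous_imp_admissible:
  assumes "n \<ge> 1" "a < b" and h: "continuous_on {a..b} h" and p: "p = \<infinity> \<or> (\<exists>r\<ge>1. p = ereal r)"
  obtains E where "admissible n p a b E" "E n = h"
proof -
  \<comment> \<open>Iterating \<open>n - k\<close> times puts \<open>h\<close> at index
    \<open>n\<close> and makes each function an antiderivative of the next, so continuity travels
    downwards from \<open>n\<close>.\<close>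
  define E where "E = (\<lambda>k. ((\<lambda>g x. integral {a..x} g) ^^ (n - k)) h)"
  have E_n: "E n = h" by (simp add: E_def)
  have E_step: "E k = (\<lambda>x. integral {a..x} (E (Suc k)))" if "k < n" for k
  proof -
    have "n - k = Suc (n - Suc k)" using that by simp
    then show ?thesis by (simp add: E_def)
  qed
  have deriv: "(E k has_real_derivative E (Suc k) x) (at x within {a..b})"
    if "k < n" "continuous_on {a..b} (E (Suc k))" "x \<in> {a..b}" for k x
    unfolding E_step[OF that(1)] using that by (intro integral_has_real_derivative)
  have cont: "continuous_on {a..b} (E k)" if "k \<le> n" for k
    using that
  proof (induction k rule: inc_induct)
    case base
    show ?case by (simp add: E_n h)
  next
    case (step k)
    have "(E k has_real_derivative E (Suc k) x) (at x within {a..b})" if "x \<in> {a..b}" for x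
      using deriv[of k x] step that by simp
    then show ?case by (rule DERIV_continuous_on)
  qed
  have deriv': "(E (n - 1) has_real_derivative h x) (at x within {a..b})" if "x \<in> {a..b}" for x
    using deriv[of "n - 1" x] that assms(1) h by (simp add: E_n)
  obtain M where M: "0 \<le> M" "\<And>x. x \<in> {a..b} \<Longrightarrow> \<bar>h x\<bar> \<le> M"
    by (rule continuous_on_Icc_bounded[OF h]) blast
  have "abs_cont_on a b (E (n - 1))"
  proof (rule lipschitz_imp_abs_cont_on[OF _ M(1)])
    fix x y assume xy: "x \<in> {a..b}" "y \<in> {a..b}"
    have "norm (E (n - 1) y - E (n - 1) x) \<le> M * norm (y - x)"
      by (rule field_differentiable_bound[of "{a..b}" "E (n - 1)" h]) (use deriv' M xy in auto)
    then show "\<bar>E (n - 1) y - E (n - 1) x\<bar> \<le> M * \<bar>y - x\<bar>" by simp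
  qed
  moreover have "AE x in lebesgue_on {a..b}. (E (n - 1) has_real_derivative h x) (at x)"
  proof -
    \<comment> \<open>At the endpoints only a one-sided derivative is available, while
      \<open>admissible\<close> asks for a two-sided one almost everywhere.\<close>
    have "{a, b} \<in> null_sets lebesgue"
      by (simp add: negligible_iff_null_sets[symmetric])
    then have "AE x in lebesgue. x \<in> {a..b} \<longrightarrow> (E (n - 1) has_real_derivative h x) (at x)"
    proof (rule AE_mp[OF AE_not_in AE_I2], intro impI)
      fix x assume "x \<notin> {a, b}" "x \<in> {a..b}"
      then show "(E (n - 1) has_real_derivative h x) (at x)"
        using deriv'[of x] at_within_Icc_at[of a x b] by auto
    qed
    then show ?thesis by (simp add: AE_restrict_space_iff)
  qed
  moreover have "in_Lp p a b h" by (rule in_Lp_continuous[OF h p])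
  ultimately have "admissible n p a b E"
    unfolding admissible_def E_n using deriv cont by simp
  then show thesis using E_n by (rule that)
qed

lemma integral_pos_continuous:
  fixes g :: "real \<Rightarrow> real"
  assumes "a < b" "continuous_on {a..b} g" "\<And>x. x \<in> {a..b} \<Longrightarrow> 0 \<le> g x" "x \<in> {a..b}" "g x \<noteq> 0"
  shows "0 < integral {a..b} g"
proof -
  have "integral {a..b} g \<noteq> 0" using integral_eq_0_iff[OF assms(2,1,3)] assms(4,5) by blast
  moreover have "0 \<le> integral {a..b} g"
    using assms by (intro integral_nonneg integrable_continuous_real) auto
  ultimately show ?thesis by simp
qed

lemma Lp_norm_pos_continuous:
  assumes "a < b" "continuous_on {a..b} g" "x \<in> {a..b}" "g x \<noteq> 0" "q = \<infinity> \<or> (\<exists>s>0. q = ereal s)"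
  shows "0 < Lp_norm q a b g"
  using assms(5)
proof (elim disjE exE conjE)
  assume q: "q = \<infinity>"
  obtain z where "Lp_norm \<infinity> a b g = \<bar>g z\<bar>" "\<And>y. y \<in> {a..b} \<Longrightarrow> \<bar>g y\<bar> \<le> \<bar>g z\<bar>"
    by (rule Lp_norm_infinity_attained[OF assms(1,2)]) blast
  with assms(3,4) q show ?thesis by fastforce
next
  fix s :: real assume s: "0 < s" "q = ereal s"
  have "0 < integral {a..b} (\<lambda>x. \<bar>g x\<bar> powr s)"
    using assms by (intro integral_pos_continuous[where x = x] continuous_on_abs_powr s(1)) auto
  then show ?thesis unfolding s(2) Lp_norm_continuous[OF assms(2) s(1)] by simp
qed

text \<open>The test functions are continuous approximations of the equality case of Hoelder's inequality.\<close>
lemma Lp_norm_holder_sharp: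
  fixes g :: "real \<Rightarrow> real"
  assumes "a < b" and pq: "conjugate_exps p q" and g: "continuous_on {a..b} g"
    and C: "0 \<le> C" "C < Lp_norm q a b g"
  obtains h where "continuous_on {a..b} h" "C * Lp_norm p a b h < integral {a..b} (\<lambda>x. h x * g x)"
  using pq
proof (cases rule: conjugate_expsE)
  case 1
  define N where "N = integral {a..b} (\<lambda>x. \<bar>g x\<bar>)"
  have N_int: "(\<lambda>x. \<bar>g x\<bar>) integrable_on {a..b}"
    using g by (intro integrable_continuous_real continuous_intros)
  have "Lp_norm q a b g = N"
    using Lp_norm_continuous[OF g, of 1] integral_nonneg[OF N_int] by (simp add: 1 N_def one_ereal_def)
  with C have "C < N" by simp
  \<comment> \<open>The function \<open>h\<close> below is a continuous substitute for the sign of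
    \<open>g\<close>. It costs at most \<open>\<epsilon>\<close> at each point, in total half of the
    gap between \<open>C\<close> and the norm.\<close>
  define \<epsilon> where "\<epsilon> = (N - C) / (2 * (b - a))"
  have "0 < \<epsilon>" using \<open>C < N\<close> \<open>a < b\<close> by (simp add: \<epsilon>_def)
  define h where "h = (\<lambda>x. g x / (\<bar>g x\<bar> + \<epsilon>))"
  have den: "\<bar>g x\<bar> + \<epsilon> \<noteq> 0" for x using \<open>0 < \<epsilon>\<close> by (smt (verit))
  have h: "continuous_on {a..b} h"
    unfolding h_def using g den by (intro continuous_intros) auto
  have "\<bar>h x\<bar> \<le> 1" for x
    using \<open>0 < \<epsilon>\<close> by (simp add: h_def abs_divide divide_le_eq)
  moreover obtain z where "Lp_norm \<infinity> a b h = \<bar>h z\<bar>"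
    by (rule Lp_norm_infinity_attained[OF \<open>a < b\<close> h]) blast
  ultimately have "Lp_norm p a b h \<le> 1" by (simp add: 1)
  then have "C * Lp_norm p a b h \<le> C" using C(1) by (simp add: mult_left_le)
  also have "C < N - \<epsilon> * (b - a)"
  proof -
    have half: "\<epsilon> * (b - a) = (N - C) / 2" using \<open>a < b\<close> by (simp add: \<epsilon>_def divide_simps)
    show ?thesis unfolding half using \<open>C < N\<close> by (simp add: field_simps)
  qed
  also have "N - \<epsilon> * (b - a) = integral {a..b} (\<lambda>x. \<bar>g x\<bar> - \<epsilon>)"
    using \<open>a < b\<close> by (subst Henstock_Kurzweil_Integration.integral_diff[OF N_int]) (auto simp: N_def)
  also have "\<dots> \<le> integral {a..b} (\<lambda>x. h x * g x)"
  proof (rule integral_le)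
    fix x
    have "(\<bar>g x\<bar> - \<epsilon>) * (\<bar>g x\<bar> + \<epsilon>) \<le> g x * g x"
      by (simp add: algebra_simps abs_mult[symmetric])
    then show "\<bar>g x\<bar> - \<epsilon> \<le> h x * g x"
      using \<open>0 < \<epsilon>\<close> by (simp add: h_def pos_le_divide_eq add_nonneg_pos)
  qed (use g h in \<open>intro integrable_continuous_real continuous_intros; simp\<close>)+
  finally show thesis using h that by blast
next
  case 2
  obtain z where z: "z \<in> {a..b}" "Lp_norm \<infinity> a b g = \<bar>g z\<bar>"
    by (rule Lp_norm_infinity_attained[OF \<open>a < b\<close> g]) blast
  define c where "c = (C + \<bar>g z\<bar>) / 2"
  have c: "C < c" "c < \<bar>g z\<bar>" using C z 2 by (simp_all add: c_def)
  \<comment> \<open>Soft thresholding at a level strictly between \<open>C\<close> and the maximum: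
    \<open>h\<close> has the sign of \<open>g\<close> and lives only where
    \<open>\<bar>g\<bar>\<close> exceeds \<open>c\<close>, in place of a point mass at a
    maximum.\<close>
  define h where "h = (\<lambda>x. max 0 (g x - c) - max 0 (- g x - c))"
  have h: "continuous_on {a..b} h"
    unfolding h_def using g by (intro continuous_intros)
  have habs: "continuous_on {a..b} (\<lambda>x. \<bar>h x\<bar>)" using h by (intro continuous_intros)
  have hg: "c * \<bar>h x\<bar> \<le> h x * g x" for x
  proof -
    have "h x * g x = \<bar>h x\<bar> * \<bar>g x\<bar>" and le: "h x = 0 \<or> c \<le> \<bar>g x\<bar>"
      using c C(1) by (auto simp: h_def max_def abs_if)
    then have "h x * g x = \<bar>g x\<bar> * \<bar>h x\<bar>" by simp
    also have "\<dots> \<ge> c * \<bar>h x\<bar>" using le by (auto intro: mult_right_mono)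
    finally show ?thesis .
  qed
  have "h z \<noteq> 0" using c C(1) by (auto simp: h_def max_def abs_if split: if_splits)
  then have pos: "0 < integral {a..b} (\<lambda>x. \<bar>h x\<bar>)"
    using \<open>a < b\<close> z(1) by (intro integral_pos_continuous[where x = z] habs) auto
  have "C * Lp_norm p a b h = C * integral {a..b} (\<lambda>x. \<bar>h x\<bar>)"
    using Lp_norm_continuous[OF h, of 1] pos by (simp add: 2 one_ereal_def)
  also have "\<dots> < c * integral {a..b} (\<lambda>x. \<bar>h x\<bar>)"
    using pos c(1) by simp
  also have "\<dots> = integral {a..b} (\<lambda>x. c * \<bar>h x\<bar>)" by simp
  also have "\<dots> \<le> integral {a..b} (\<lambda>x. h x * g x)"
    by (rule integral_le)
      (use h g habs hg in \<open>auto intro!: integrable_continuous_real continuous_intros\<close>)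
  finally show thesis using h that by blast
next
  case (3 r s)
  define I where "I = integral {a..b} (\<lambda>x. \<bar>g x\<bar> powr s)"
  have s0: "0 < s" "0 < r" "0 < s - 1" using 3 by auto
  have norm_g: "Lp_norm q a b g = I powr (1 / s)"
    unfolding 3(2) I_def by (rule Lp_norm_continuous[OF g s0(1)])
  have "0 \<le> I" unfolding I_def
    by (intro integral_nonneg integrable_continuous_real continuous_on_abs_powr[OF g s0(1)]) auto
  moreover have "I \<noteq> 0" using C norm_g by auto
  ultimately have "0 < I" by simp
  \<comment> \<open>The exact equality case, sign of \<open>g\<close> times
    \<open>\<bar>g\<bar> powr (s - 1)\<close>, split into positive and negative parts so that it is
    visibly continuous at zeros of \<open>g\<close>. Conjugacy gives \<open>r * (s - 1) = s\<close>,
    so \<open>\<bar>h\<bar> powr r\<close> equals \<open>\<bar>g\<bar> powr s\<close>.\<close>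
  define h where "h = (\<lambda>x. max 0 (g x) powr (s - 1) - max 0 (- g x) powr (s - 1))"
  have h: "continuous_on {a..b} h"
    unfolding h_def using g s0 by (intro continuous_intros continuous_on_powr') auto
  have h_abs: "\<bar>h x\<bar> = \<bar>g x\<bar> powr (s - 1)" for x
    using s0 by (auto simp: h_def max_def abs_if)
  have "s = r * (s - 1)" using 3(3-5) by (simp add: field_simps)
  then have "Lp_norm p a b h = I powr (1 / r)"
    unfolding 3(1) Lp_norm_continuous[OF h s0(2)] I_def by (simp add: h_abs powr_powr mult.commute)
  moreover have "h x * g x = \<bar>g x\<bar> powr s" for x
  proof (cases "g x" "0::real" rule: linorder_cases)
    case less
    then show ?thesis using s0 powr_mult_base[of "- g x" "s - 1"] by (simp add: h_def max_def mult.commute)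
  next
    case greater
    then show ?thesis using s0 powr_mult_base[of "g x" "s - 1"] by (simp add: h_def max_def mult.commute)
  qed (use s0 in simp)
  then have "integral {a..b} (\<lambda>x. h x * g x) = I" by (simp add: I_def)
  moreover have "C * I powr (1 / r) < I"
  proof -
    have "C * I powr (1 / r) < I powr (1 / s) * I powr (1 / r)"
      using C norm_g \<open>0 < I\<close> by (intro mult_strict_right_mono) auto
    also have "\<dots> = I powr (1 / r + 1 / s)" by (simp add: powr_add)
    also have "\<dots> = I" using 3(5) \<open>0 < I\<close> by simp
    finally show ?thesis .
  qed
  ultimately show thesis using h that by simp
qed

lemma K_const_minimizer_unique:
  assumes "n \<ge> 1" and q: "q = \<infinity> \<or> (\<exists>s\<ge>1. q = ereal s)"
  shows "\<exists>!\<psi>. monic_deg n \<psi> \<and> (\<forall>\<rho>. monic_deg n \<rho> \<longrightarrow> K_const n q \<psi> \<le> K_const n q \<rho>)"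
proof -
  define N where "N = (\<lambda>\<psi>. Lp_norm q (-1) 1 (poly \<psi>))"
  have "K_const n q \<psi> = 2 powr (- real n - inv_exp q) / fact n * N \<psi>" for \<psi>
    by (simp add: K_const_def N_def)
  moreover have "0 < (2::real) powr (- real n - inv_exp q) / fact n" by simp
  ultimately have K: "K_const n q \<psi> \<le> K_const n q \<rho> \<longleftrightarrow> N \<psi> \<le> N \<rho>" for \<psi> \<rho>
    by (simp only: mult_le_cancel_left_pos)
  have cont: "continuous_on {-1..1} (poly \<psi>)" for \<psi> :: "real poly"
    by (intro continuous_intros)
  from q have "\<exists>!\<psi>. monic_deg n \<psi> \<and> (\<forall>\<rho>. monic_deg n \<rho> \<longrightarrow> N \<psi> \<le> N \<rho>)"
  proof (elim disjE exE conjE)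
    assume q: "q = \<infinity>"
    obtain T M where T: "monic_deg n T" "\<And>x. x \<in> {-1..1} \<Longrightarrow> \<bar>poly T x\<bar> \<le> M"
      "\<exists>x\<in>{-1..1}. \<bar>poly T x\<bar> = M"
      and uniq: "\<And>\<psi>. \<lbrakk>monic_deg n \<psi>; \<And>x. x \<in> {-1..1} \<Longrightarrow> \<bar>poly \<psi> x\<bar> \<le> M\<rbrakk> \<Longrightarrow> \<psi> = T"
      by (rule chebyshev_minimax[OF assms(1)]) blast
    have N: "\<exists>z\<in>{-1..1}. N \<psi> = \<bar>poly \<psi> z\<bar> \<and> (\<forall>x\<in>{-1..1}. \<bar>poly \<psi> x\<bar> \<le> N \<psi>)" for \<psi>
    proof -
      obtain z where "z \<in> {-1..1}" "Lp_norm \<infinity> (-1) 1 (poly \<psi>) = \<bar>poly \<psi> z\<bar>"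
        "\<And>y. y \<in> {-1..1} \<Longrightarrow> \<bar>poly \<psi> y\<bar> \<le> \<bar>poly \<psi> z\<bar>"
        by (rule Lp_norm_infinity_attained[OF _ cont]) auto
      then show ?thesis unfolding N_def q by auto
    qed
    have "N T \<le> M" using N[of T] T(2) by auto
    have le_N: "M \<le> N \<rho>" if "monic_deg n \<rho>" for \<rho>
    proof (rule ccontr)
      assume less: "\<not> M \<le> N \<rho>"
      \<comment> \<open>A norm below \<open>M\<close> would identify the competitor with
        \<open>T\<close>, whose norm is at least \<open>M\<close>.\<close>
      then have "\<rho> = T" using N[of \<rho>] by (intro uniq that) force
      moreover have "M \<le> N T" using N[of T] T(3) by auto
      ultimately show False using less by simp
    qed
    show ?thesis
    proof (rule ex1I[of _ T])
      show "monic_deg n T \<and> (\<forall>\<rho>. monic_deg n \<rho> \<longrightarrow> N T \<le> N \<rho>)"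
        using T(1) \<open>N T \<le> M\<close> le_N by (auto intro: order_trans)
      fix \<psi> assume \<psi>: "monic_deg n \<psi> \<and> (\<forall>\<rho>. monic_deg n \<rho> \<longrightarrow> N \<psi> \<le> N \<rho>)"
      then have "N \<psi> \<le> M" using T(1) \<open>N T \<le> M\<close> by (auto intro: order_trans)
      with \<psi> show "\<psi> = T" using N[of \<psi>] by (intro uniq) (auto intro: order_trans)
    qed
  next
    fix s :: real assume s: "1 \<le> s" "q = ereal s"
    then have "0 < s" by simp
    have N: "N \<psi> = power_integral s \<psi> powr (1 / s)" for \<psi>
      unfolding N_def s(2) power_integral_def by (rule Lp_norm_continuous[OF cont \<open>0 < s\<close>])
    have N_le: "N \<psi> \<le> N \<rho> \<longleftrightarrow> power_integral s \<psi> \<le> power_integral s \<rho>" for \<psi> \<rho>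
      unfolding N using \<open>0 < s\<close> power_integral_nonneg[OF \<open>0 < s\<close>]
      by (meson divide_pos_pos less_imp_le not_le powr_less_mono2 powr_mono2 zero_less_one)
    obtain \<psi> where \<psi>: "monic_deg n \<psi>" "\<And>\<rho>. monic_deg n \<rho> \<Longrightarrow> power_integral s \<psi> \<le> power_integral s \<rho>"
      by (rule power_integral_attains_min[OF \<open>0 < s\<close>]) blast
    show ?thesis
      unfolding N_le
    proof (rule ex1I[of _ \<psi>])
      show "\<rho> = \<psi>" if "monic_deg n \<rho> \<and> (\<forall>\<rho>'. monic_deg n \<rho>' \<longrightarrow> power_integral s \<rho> \<le> power_integral s \<rho>')" for \<rho>
        using that by (intro power_integral_min_unique[OF s(1) _ \<psi>(1) _ \<psi>(2)]) auto
    qed (use \<psi> in blast)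
  qed
  then show ?thesis by (simp only: K)
qed

text \<open>\<open>E n\<close> can be any continuous function, so near-equality in Hoelder's
  inequality against \<open>poly \<phi>\<close> becomes a near-extremal error term. The factors
  \<open>B\<close> and \<open>fact n\<close> translate \<open>K_const\<close> into the norm of
  \<open>poly \<phi>\<close>.\<close>

lemma err_term_sharp:
  assumes "n \<ge> 1" "a < b" and pq: "conjugate_exps p q" and phi: "monic_deg n \<phi>"
    and C: "C < K_const n q (tilde_poly n a b \<phi>)"
  shows "\<exists>E. admissible n p a b E \<and>
    C * Lp_norm p a b (E n) * (b - a) powr (real n + inv_exp q) < \<bar>err_term n a b \<phi> E\<bar>"
proof -
  define B where "B = (b - a) powr (real n + inv_exp q)"
  have "0 < B" using assms(2) by (simp add: B_def)
  have p: "p = \<infinity> \<or> (\<exists>r\<ge>1. p = ereal r)" and q: "q = \<infinity> \<or> (\<exists>s>0. q = ereal s)"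
    using pq by (auto elim!: conjugate_expsE simp: one_ereal_def)
  have cont: "continuous_on S (poly \<phi>)" for S by (intro continuous_intros)
  have K: "Lp_norm q a b (poly \<phi>) = K_const n q (tilde_poly n a b \<phi>) * B * fact n"
    using Lp_norm_eq_K_const[OF assms(2) q, of \<phi> n] by (simp add: B_def field_simps)
  \<comment> \<open>A monic polynomial has finitely many zeros, so its norm is positive, which
    settles the case \<open>C \<le> 0\<close>.\<close>
  have "infinite {a..b}" using assms(2) by simp
  then have "\<not> {a..b} \<subseteq> {x. poly \<phi> x = 0}"
    using poly_roots_finite[OF monic_deg_nonzero[OF phi]] finite_subset by blast
  then obtain x where "x \<in> {a..b}" "poly \<phi> x \<noteq> 0" by blast
  then have "0 < Lp_norm q a b (poly \<phi>)"
    by (intro Lp_norm_pos_continuous[OF assms(2) cont _ _ q])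
  \<comment> \<open>The near-extremal function needs a nonnegative constant. Raising a negative
    \<open>C\<close> to 0 only strengthens the claim, as the norm of \<open>h\<close> is
    nonnegative.\<close>
  define C0 where "C0 = max C 0"
  have "C0 * B * fact n < Lp_norm q a b (poly \<phi>)"
  proof (cases "C \<le> 0")
    case True
    then show ?thesis using \<open>0 < Lp_norm q a b (poly \<phi>)\<close> by (simp add: C0_def)
  next
    case False
    then show ?thesis using C \<open>0 < B\<close> unfolding K by (simp add: C0_def mult_strict_right_mono)
  qed
  moreover have "0 \<le> C0 * B * fact n" using \<open>0 < B\<close> by (simp add: C0_def)
  ultimately obtain h where h: "continuous_on {a..b} h"
    and less: "C0 * B * fact n * Lp_norm p a b h < integral {a..b} (\<lambda>x. h x * poly \<phi> x)"
    using Lp_norm_holder_sharp[OF assms(2) pq cont] by metis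
  obtain E where E: "admissible n p a b E" "E n = h"
    by (rule continuous_imp_admissible[OF assms(1,2) h p])
  have "0 \<le> Lp_norm p a b h"
    by (rule Lp_norm_nonneg[OF in_Lp_continuous[OF h p] assms(2)])
  then have "C * Lp_norm p a b h * B \<le> C0 * Lp_norm p a b h * B"
    using \<open>0 < B\<close> by (intro mult_right_mono) (auto simp: C0_def)
  also have "\<dots> < integral {a..b} (\<lambda>x. h x * poly \<phi> x) / fact n"
    using less by (simp add: pos_less_divide_eq algebra_simps)
  also have "\<dots> = integral\<^sup>L (lebesgue_on {a..b}) (\<lambda>x. E n x * poly \<phi> x) / fact n"
    unfolding E(2) by (subst integral_lebesgue_on_continuous) (intro continuous_intros h, simp)
  also have "\<dots> \<le> \<bar>err_term n a b \<phi> E\<bar>"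
    by (simp add: err_term_def abs_mult power_abs divide_right_mono)
  finally show ?thesis using E by (auto simp: B_def)
qed

theorem theorem2p1:
  fixes n :: nat and a b :: real and p q :: ereal and \<phi> :: "real poly"
    and f :: "real \<Rightarrow> real" and D :: "nat \<Rightarrow> real \<Rightarrow> real"
  assumes n: "n \<ge> 1"
    and ab: "a < b"
    and pq: "conjugate_exps p q"
    and f: "D 0 = f"
    and adm: "admissible n p a b D"
    and phi: "monic_deg n \<phi>"
  shows
    "(integral\<^sup>L (lebesgue_on {a..b}) f =
       (-1) ^ n / fact n *
         (\<Sum>k<n. (-1) ^ (n - k - 1) *
            (poly ((pderiv ^^ (n - k - 1)) \<phi>) a * D k a
             - poly ((pderiv ^^ (n - k - 1)) \<phi>) b * D k b))
       + err_term n a b \<phi> D) \<and>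
    (\<forall>x. poly \<phi> x = ((b - a) / 2) ^ n * poly (tilde_poly n a b \<phi>) ((2 * x - a - b) / (b - a))) \<and>
    (monic_deg n (tilde_poly n a b \<phi>)) \<and>
    (\<bar>err_term n a b \<phi> D\<bar> \<le> Lp_norm p a b (D n) * Lp_norm q a b (poly \<phi>) / fact n) \<and>
    (Lp_norm p a b (D n) * Lp_norm q a b (poly \<phi>) / fact n
         \<le> K_const n q (tilde_poly n a b \<phi>) * Lp_norm p a b (D n) * (b - a) powr (real n + inv_exp q)) \<and>
    (\<exists>!\<psi>. monic_deg n \<psi> \<and> (\<forall>\<rho>. monic_deg n \<rho> \<longrightarrow> K_const n q \<psi> \<le> K_const n q \<rho>)) \<and>
    ((\<forall>\<rho>. monic_deg n \<rho> \<longrightarrow> K_const n q (tilde_poly n a b \<phi>) \<le> K_const n q \<rho>) \<longrightarrow>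
         (\<forall>C::real. C < K_const n q (tilde_poly n a b \<phi>) \<longrightarrow>
           (\<exists>E. admissible n p a b E \<and>
              \<bar>err_term n a b \<phi> E\<bar> > C * Lp_norm p a b (E n) * (b - a) powr (real n + inv_exp q))))"
proof (intro conjI)
  have p: "p = \<infinity> \<or> (\<exists>r\<ge>1. p = ereal r)" and q: "q = \<infinity> \<or> (\<exists>s\<ge>1. q = ereal s)"
    using pq by (auto elim!: conjugate_expsE simp: one_ereal_def)
  from q have q0: "q = \<infinity> \<or> (\<exists>s>0. q = ereal s)"
    by (elim disjE exE conjE) auto
  show "integral\<^sup>L (lebesgue_on {a..b}) f =
       (-1) ^ n / fact n *
         (\<Sum>k<n. (-1) ^ (n - k - 1) *
            (poly ((pderiv ^^ (n - k - 1)) \<phi>) a * D k a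
             - poly ((pderiv ^^ (n - k - 1)) \<phi>) b * D k b))
       + err_term n a b \<phi> D"
    unfolding f[symmetric] by (rule quadrature_identity[OF n ab p adm phi])
  show "\<forall>x. poly \<phi> x = ((b - a) / 2) ^ n * poly (tilde_poly n a b \<phi>) ((2 * x - a - b) / (b - a))"
    using poly_tilde_poly[OF ab] by blast
  show "monic_deg n (tilde_poly n a b \<phi>)"
    by (rule monic_deg_tilde_poly[OF ab phi])
  have Dn: "in_Lp p a b (D n)" using adm by (simp add: admissible_def)
  have "continuous_on {a..b} (poly \<phi>)" by (intro continuous_intros)
  from Lp_norm_holder[OF ab pq Dn this]
  show "\<bar>err_term n a b \<phi> D\<bar> \<le> Lp_norm p a b (D n) * Lp_norm q a b (poly \<phi>) / fact n"
    by (simp add: err_term_def abs_mult power_abs divide_right_mono)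
  show "Lp_norm p a b (D n) * Lp_norm q a b (poly \<phi>) / fact n
         \<le> K_const n q (tilde_poly n a b \<phi>) * Lp_norm p a b (D n) * (b - a) powr (real n + inv_exp q)"
  proof -
    \<comment> \<open>By the rescaling identity this estimate is in fact an equality.\<close>
    have "Lp_norm p a b (D n) * Lp_norm q a b (poly \<phi>) / fact n
        = Lp_norm p a b (D n) * (Lp_norm q a b (poly \<phi>) / fact n)" by simp
    then show ?thesis
      unfolding Lp_norm_eq_K_const[OF ab q0, of \<phi> n] by (simp add: algebra_simps)
  qed
  show "\<exists>!\<psi>. monic_deg n \<psi> \<and> (\<forall>\<rho>. monic_deg n \<rho> \<longrightarrow> K_const n q \<psi> \<le> K_const n q \<rho>)"
    by (rule K_const_minimizer_unique[OF n q])
  show "(\<forall>\<rho>. monic_deg n \<rho> \<longrightarrow> K_const n q (tilde_poly n a b \<phi>) \<le> K_const n q \<rho>) \<longrightarrow>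
         (\<forall>C::real. C < K_const n q (tilde_poly n a b \<phi>) \<longrightarrow>
           (\<exists>E. admissible n p a b E \<and>
              \<bar>err_term n a b \<phi> E\<bar> > C * Lp_norm p a b (E n) * (b - a) powr (real n + inv_exp q)))"
    using err_term_sharp[OF n ab pq phi] by blast
qed

end
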